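(* Let Problems 1, 2 and 3 be the optimal control problems defined in the context (with common data $A,B,N,\mathbf{k},\mathcal{Q},R,\lambda,\mathbf{x}_0$ and disturbances $w_0,\dots,w_{N-1}$ satisfying $\mathbb{E}(|w_t|^4)<\infty$ for every $t\in\{0,\dots,N-1\}$). If $\mathbf{u}^*$ is optimal for Problem 1, Problem 2, or Problem 3, then $\mathbf{u}^*$ is optimal for the remaining two problems.
   Context: Notation: $\mathcal{S}_n$ ($\mathcal{S}_n^+$) is the set of $n\times n$ real symmetric positive semidefinite (definite) matrices; $I_n$ is the identity; $0_{n\times m}$ is the $n\times m$ zero matrix; $y\in\mathcal{L}^2(\mathcal{F})$ means $y$ is an $\mathcal{F}$-measurable random vector with $\mathbb{E}(|y|^2)<\infty$; $\sigma(\cdot)$ is the $\sigma$-algebra generated by a random vector; a.s. means almost surely; $\mathbf{u}$ is shorthand for $(u_0,\dots,u_{N-1})$. Parameters: $\lambda\in[0,\infty)$, $R\in\mathcal{S}_m^+$. System: fix $N\in\mathbb{N}=\{1,2,\dots\}$ and deterministic $A\in\mathbb{R}^{n\times n}$, $B\in\mathbb{R}^{n\times m}$. On a probability space $(\Omega,\mathcal{G},\mathbb{P})$, consider $$x_{t+1}=Ax_t+Bu_t+w_t,\quad t\in\{0,\dots,N-1\},\qquad (\mathrm{S})$$ where $x_t,w_t$ are $\mathbb{R}^n$-valued and $u_t$ is $\mathbb{R}^m$-valued. The vectors $x_0,w_0,\dots,w_{N-1}$ are independent, $w_0,\dots,w_{N-1}$ are identically distributed with $\mathbb{E}(|w_t|^4)<\infty$,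 and $x_0=\mathbf{x}_0$ a.s. for a deterministic $\mathbf{x}_0\in\mathbb{R}^n$. Let $\mathcal{F}_t:=\sigma(h_t)$, $h_0:=x_0$, $h_t:=[x_0^\top,u_0^\top,\dots,x_{t-1}^\top,u_{t-1}^\top,x_t^\top]^\top$ for $t\in\{1,\dots,N\}$. Temporal coupling: fix $\mathbf{k}\in\{0,\dots,N\}$ and $\mathcal{Q}\in\mathcal{S}_{n(\mathbf{k}+1)}$ partitioned into $n\times n$ blocks $Q_{ij}$, $i,j\in\{0,\dots,\mathbf{k}\}$ (block row $i$, block column $j$). For $t\in\{0,\dots,N\}$ let $\mathbf{k}_t:=\min\{\mathbf{k},t\}$, $n_t:=n(\mathbf{k}_t+1)$, $\eta_t:=[x_t^\top\;\cdots\;x_{t-\mathbf{k}_t}^\top]^\top$, let $\mathcal{Q}_t$ be formed by the first $n_t$ rows and columns of $\mathcal{Q}$, and let $z_t:=\eta_t^\top\mathcal{Q}_t\eta_t$. For $t\in\{1,\dots,N\}$ let $\Delta_t:=z_t-\mathbb{E}(z_t\mid\mathcal{F}_{t-1})$. Noise statistics (independent of $t$): $\bar w:=\mathbb{E}(w_{t-1})$, $d_t:=w_{t-1}-\bar w$ for $t\in\{1,\dots,N\}$, $\Sigma:=\mathbb{E}(d_td_t^\top)$, $\gamma:=\mathbb{E}(d_td_t^\top Q_{00}d_t)$. Cost functions: for $t\in\{0,\dots,N\}$ let $\zeta_t:=4[Q_{00}^\top\;\cdots\;Q_{\mathbf{k}_t0}^\top]^\top\gamma$, let $H_t$ be the $n_t\times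 n_t$ block matrix with $(i,j)$ block $4Q_{i0}\Sigma Q_{0j}$, $i,j\in\{0,\dots,\mathbf{k}_t\}$, and let $\mathcal{Q}_{\lambda,t}:=\mathcal{Q}_t+\lambda H_t$. Define $c_N(\eta):=\eta^\top\mathcal{Q}_{\lambda,N}\eta+\lambda\zeta_N^\top\eta$ on $\mathbb{R}^{n_N}$ and $c_t(\eta,u):=\eta^\top\mathcal{Q}_{\lambda,t}\eta+\lambda\zeta_t^\top\eta+u^\top Ru$ on $\mathbb{R}^{n_t}\times\mathbb{R}^m$ for $t\in\{0,\dots,N-1\}$. Augmented dynamics: for $t\in\{0,\dots,N-1\}$, $$\eta_{t+1}=f_t(\eta_t,u_t,w_t),\quad f_t(\eta,u,w):=\tilde A_t\eta+\tilde B_tu+\tilde C_tw,\qquad(\mathrm{AS})$$ where, if $\mathbf{k}=0$, $\tilde A_t:=A$, $\tilde B_t:=B$, $\tilde C_t:=I_n$; and if $\mathbf{k}\ge1$, $$\tilde A_t:=\begin{bmatrix}A_t \\ D_t\end{bmatrix},\quad\tilde B_t:=\begin{bmatrix}B \\ 0_{n\mathbf{k}_{t+1}\times m}\end{bmatrix},\quad\tilde C_t:=\begin{bmatrix}I_n \\ 0_{n\mathbf{k}_{t+1}\times n}\end{bmatrix},$$ with $A_t:=[A\;\;0_{n\times n\mathbf{k}_t}]$ if $\mathbf{k}_t\ge1$, $A_t:=A$ if $\mathbf{k}_t=0$; $D_t:=[I_{n\mathbf{k}}\;\;0_{n\mathbf{k}\times n}]$ if $t\ge\mathbf{k}$, $D_t:=I_{n(t+1)}$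 if $t<\mathbf{k}$. Let $\mathcal{G}_t:=\sigma(g_t)$, $g_0:=\eta_0$, $g_t:=[\eta_0^\top,u_0^\top,\dots,\eta_{t-1}^\top,u_{t-1}^\top,\eta_t^\top]^\top$ for $t\in\{1,\dots,N\}$. Problem 1: minimize over $\mathbf{u}$ $$\mathcal{J}_\lambda(\mathbf{u}):=\mathbb{E}\Big(z_N+\sum_{t=0}^{N-1}(z_t+u_t^\top Ru_t)\Big)+\lambda\,\mathbb{E}\Big(\sum_{t=1}^N\Delta_t^2\Big)$$ subject to (S), $x_0=\mathbf{x}_0$ a.s., and $u_t\in\mathcal{L}^2(\mathcal{F}_t)$ for $t\in\{0,\dots,N-1\}$. Problem 2: minimize over $\mathbf{u}$ $$\mathbb{E}\Big(c_N(\eta_N)+\sum_{t=0}^{N-1}c_t(\eta_t,u_t)\Big)$$ subject to (S), $x_0=\mathbf{x}_0$ a.s., and $u_t\in\mathcal{L}^2(\mathcal{F}_t)$ for $t\in\{0,\dots,N-1\}$. Problem 3: minimize over $\mathbf{u}$ the same objective as in Problem 2, subject to (AS), $\eta_0=\mathbf{x}_0$ a.s., and $u_t\in\mathcal{L}^2(\mathcal{G}_t)$ for $t\in\{0,\dots,N-1\}$. "Optimal" means feasible and attaining the infimum. *)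

theory Defs
  imports "HOL-Probability.Probability"
begin

definition sym_pos_def :: "real^'m^'m \<Rightarrow> bool" where
  "sym_pos_def R \<longleftrightarrow> transpose R = R \<and> (\<forall>v. v \<noteq> 0 \<longrightarrow> v \<bullet> (R *v v) > 0)"

text \<open>
  The dimension n (k + 1) of the augmented vectors varies with time, so vectors and matrices of
  this kind are kept in block form.  A vector with blocks 0, ..., p in R^n is a function
  \<open>nat \<Rightarrow> real^'n\<close>, taken extensional on \<open>{..p}\<close> where it is an element of the space \<open>block_borel p\<close>.
  A matrix is a function \<open>nat \<Rightarrow> nat \<Rightarrow> real^'n^'n\<close> (block row, block column); the entries outside
  the stated index range are never used.
\<close>

definition block_borel :: "nat \<Rightarrow> (nat \<Rightarrow> 'b::euclidean_space) measure" where
  "block_borel p = PiM {..p} (\<lambda>_. borel)"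

definition block_quad :: "nat \<Rightarrow> (nat \<Rightarrow> nat \<Rightarrow> real^'n^'n) \<Rightarrow> (nat \<Rightarrow> real^'n) \<Rightarrow> real" where
  "block_quad p P v = (\<Sum>i\<le>p. v i \<bullet> (\<Sum>j\<le>p. P i j *v v j))"

definition block_sym_pos_semidef :: "nat \<Rightarrow> (nat \<Rightarrow> nat \<Rightarrow> real^'n^'n) \<Rightarrow> bool" where
  "block_sym_pos_semidef p P \<longleftrightarrow>
     (\<forall>i\<le>p. \<forall>j\<le>p. transpose (P i j) = P j i) \<and> (\<forall>v. block_quad p P v \<ge> 0)"

definition outer :: "real^'n \<Rightarrow> real^'n \<Rightarrow> real^'n^'n" where
  "outer v v' = (\<chi> i j. v $ i * v' $ j)"

definition square_integrable :: "'a measure \<Rightarrow> 'a measure \<Rightarrow> ('a \<Rightarrow> 'b::euclidean_space) \<Rightarrow> bool" where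
  "square_integrable M F y \<longleftrightarrow> y \<in> borel_measurable F \<and> integrable M (\<lambda>\<omega>. (norm (y \<omega>))\<^sup>2)"

definition attains_infimum :: "('p \<Rightarrow> real) \<Rightarrow> 'p set \<Rightarrow> 'p \<Rightarrow> bool" where
  "attains_infimum J S p \<longleftrightarrow> p \<in> S \<and> ereal (J p) = (INF q\<in>S. ereal (J q))"

text \<open>
  \<open>X0\<close> is the random initial state and \<open>xinit\<close> its deterministic almost sure value.  A control is
  a process \<open>u\<close> of which only the values at times below \<open>N\<close> matter.
\<close>

locale coupled_lq = prob_space M
  for M :: "'a measure" +
  fixes N :: nat
    and A :: "real^'n^'n"
    and B :: "real^'m^'n"
    and k :: nat
    and Q :: "nat \<Rightarrow> nat \<Rightarrow> real^'n^'n"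
    and R :: "real^'m^'m"
    and lam :: real
    and xinit :: "real^'n"
    and X0 :: "'a \<Rightarrow> real^'n"
    and w :: "nat \<Rightarrow> 'a \<Rightarrow> real^'n"
  assumes N_pos: "N \<ge> 1"
    and k_le: "k \<le> N"
    and Q_psd: "block_sym_pos_semidef k Q"
    and R_pd: "sym_pos_def R"
    and lam_nonneg: "lam \<ge> 0"
    and indep: "indep_vars (\<lambda>_. borel) (case_nat X0 w) {..N}"
    and ident_distr: "\<And>t. t < N \<Longrightarrow> distr M borel (w t) = distr M borel (w 0)"
    and fourth_moment: "\<And>t. t < N \<Longrightarrow> integrable M (\<lambda>\<omega>. norm (w t \<omega>) ^ 4)"
    and X0_AE: "AE \<omega> in M. X0 \<omega> = xinit"
begin

primrec state :: "(nat \<Rightarrow> 'a \<Rightarrow> real^'m) \<Rightarrow> nat \<Rightarrow> 'a \<Rightarrow> real^'n" where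
  "state u 0 \<omega> = X0 \<omega>"
| "state u (Suc t) \<omega> = A *v state u t \<omega> + B *v u t \<omega> + w t \<omega>"

text \<open>The stacked vector h_t up to a permutation of its components, which does not affect the
  generated sigma-algebra.\<close>

definition hist :: "(nat \<Rightarrow> 'a \<Rightarrow> real^'m) \<Rightarrow> nat \<Rightarrow> 'a \<Rightarrow> (nat \<Rightarrow> real^'n) \<times> (nat \<Rightarrow> real^'m)" where
  "hist u t \<omega> = ((\<lambda>s\<in>{..t}. state u s \<omega>), (\<lambda>s\<in>{..<t}. u s \<omega>))"

definition hist_algebra :: "(nat \<Rightarrow> 'a \<Rightarrow> real^'m) \<Rightarrow> nat \<Rightarrow> 'a measure" where
  "hist_algebra u t = vimage_algebra (space M) (hist u t)
     (PiM {..t} (\<lambda>_. borel) \<Otimes>\<^sub>M PiM {..<t} (\<lambda>_. borel))"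

definition lag :: "nat \<Rightarrow> nat" where
  "lag t = min k t"

definition eta :: "(nat \<Rightarrow> 'a \<Rightarrow> real^'m) \<Rightarrow> nat \<Rightarrow> 'a \<Rightarrow> nat \<Rightarrow> real^'n" where
  "eta u t \<omega> = (\<lambda>i\<in>{..lag t}. state u (t - i) \<omega>)"

definition z :: "(nat \<Rightarrow> 'a \<Rightarrow> real^'m) \<Rightarrow> nat \<Rightarrow> 'a \<Rightarrow> real" where
  "z u t \<omega> = block_quad (lag t) Q (eta u t \<omega>)"

definition Delta :: "(nat \<Rightarrow> 'a \<Rightarrow> real^'m) \<Rightarrow> nat \<Rightarrow> 'a \<Rightarrow> real" where
  "Delta u t \<omega> = z u t \<omega> - real_cond_exp M (hist_algebra u (t - 1)) (z u t) \<omega>"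

text \<open>The noise statistics do not depend on the time index; they are taken at the first noise.\<close>

definition noise_mean :: "real^'n" where
  "noise_mean = expectation (w 0)"

definition noise_dev :: "'a \<Rightarrow> real^'n" where
  "noise_dev \<omega> = w 0 \<omega> - noise_mean"

definition noise_cov :: "real^'n^'n" where
  "noise_cov = expectation (\<lambda>\<omega>. outer (noise_dev \<omega>) (noise_dev \<omega>))"

definition noise_skew :: "real^'n" where
  "noise_skew = expectation (\<lambda>\<omega>. outer (noise_dev \<omega>) (noise_dev \<omega>) *v (Q 0 0 *v noise_dev \<omega>))"

definition zeta :: "nat \<Rightarrow> real^'n" where
  "zeta i = 4 *\<^sub>R (Q i 0 *v noise_skew)"

definition H :: "nat \<Rightarrow> nat \<Rightarrow> real^'n^'n" where
  "H i j = 4 *\<^sub>R (Q i 0 ** noise_cov ** Q 0 j)"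

definition Q_lam :: "nat \<Rightarrow> nat \<Rightarrow> real^'n^'n" where
  "Q_lam i j = Q i j + lam *\<^sub>R H i j"

definition state_cost :: "nat \<Rightarrow> (nat \<Rightarrow> real^'n) \<Rightarrow> real" where
  "state_cost t e = block_quad (lag t) Q_lam e + lam * (\<Sum>i\<le>lag t. zeta i \<bullet> e i)"

definition stage_cost :: "nat \<Rightarrow> (nat \<Rightarrow> real^'n) \<Rightarrow> real^'m \<Rightarrow> real" where
  "stage_cost t e v = state_cost t e + v \<bullet> (R *v v)"

text \<open>
  Blocks of the augmented dynamics at time \<open>t\<close>: block rows range over \<open>{..lag (Suc t)}\<close> and block
  columns over \<open>{..lag t}\<close>.  Within these ranges the lower part D_t has \<open>lag (Suc t)\<close> block rows,
  and both of its defining cases (\<open>[I 0]\<close> for t at least k, \<open>I\<close> otherwise) have the identity in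
  block (i, i) and zeros elsewhere.  For \<open>k = 0\<close> only block row 0 is present.
\<close>

definition A_aug :: "nat \<Rightarrow> nat \<Rightarrow> real^'n^'n" where
  "A_aug i j = (case i of 0 \<Rightarrow> (if j = 0 then A else 0)
                        | Suc i' \<Rightarrow> (if j = i' then mat 1 else 0))"

definition B_aug :: "nat \<Rightarrow> real^'m^'n" where
  "B_aug i = (if i = 0 then B else 0)"

definition C_aug :: "nat \<Rightarrow> real^'n^'n" where
  "C_aug i = (if i = 0 then mat 1 else 0)"

definition f_aug :: "nat \<Rightarrow> (nat \<Rightarrow> real^'n) \<Rightarrow> real^'m \<Rightarrow> real^'n \<Rightarrow> nat \<Rightarrow> real^'n" where
  "f_aug t e v d = (\<lambda>i\<in>{..lag (Suc t)}. (\<Sum>j\<le>lag t. A_aug i j *v e j) + B_aug i *v v + C_aug i *v d)"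

text \<open>The augmented process generated by its own recursion, from the same initial vector.\<close>

primrec eta_dyn :: "(nat \<Rightarrow> 'a \<Rightarrow> real^'m) \<Rightarrow> nat \<Rightarrow> 'a \<Rightarrow> nat \<Rightarrow> real^'n" where
  "eta_dyn u 0 \<omega> = (\<lambda>i\<in>{..0}. X0 \<omega>)"
| "eta_dyn u (Suc t) \<omega> = f_aug t (eta_dyn u t \<omega>) (u t \<omega>) (w t \<omega>)"

definition hist_aug ::
  "(nat \<Rightarrow> 'a \<Rightarrow> real^'m) \<Rightarrow> nat \<Rightarrow> 'a \<Rightarrow> (nat \<Rightarrow> nat \<Rightarrow> real^'n) \<times> (nat \<Rightarrow> real^'m)" where
  "hist_aug u t \<omega> = ((\<lambda>s\<in>{..t}. eta_dyn u s \<omega>), (\<lambda>s\<in>{..<t}. u s \<omega>))"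

definition hist_aug_algebra :: "(nat \<Rightarrow> 'a \<Rightarrow> real^'m) \<Rightarrow> nat \<Rightarrow> 'a measure" where
  "hist_aug_algebra u t = vimage_algebra (space M) (hist_aug u t)
     (PiM {..t} (\<lambda>s. block_borel (lag s)) \<Otimes>\<^sub>M PiM {..<t} (\<lambda>_. borel))"

definition feasible :: "(nat \<Rightarrow> 'a \<Rightarrow> real^'m) set" where
  "feasible = {u. \<forall>t<N. square_integrable M (hist_algebra u t) (u t)}"

definition feasible_aug :: "(nat \<Rightarrow> 'a \<Rightarrow> real^'m) set" where
  "feasible_aug = {u. \<forall>t<N. square_integrable M (hist_aug_algebra u t) (u t)}"

text \<open>On the feasible sets all integrands below are integrable, so the expectations are genuine.\<close>

definition J_risk :: "(nat \<Rightarrow> 'a \<Rightarrow> real^'m) \<Rightarrow> real" where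
  "J_risk u = expectation (\<lambda>\<omega>. z u N \<omega> + (\<Sum>t<N. z u t \<omega> + u t \<omega> \<bullet> (R *v u t \<omega>)))
     + lam * expectation (\<lambda>\<omega>. \<Sum>t=1..N. (Delta u t \<omega>)\<^sup>2)"

definition J_aug :: "(nat \<Rightarrow> 'a \<Rightarrow> nat \<Rightarrow> real^'n) \<Rightarrow> (nat \<Rightarrow> 'a \<Rightarrow> real^'m) \<Rightarrow> real" where
  "J_aug e u = expectation (\<lambda>\<omega>. state_cost N (e N \<omega>) + (\<Sum>t<N. stage_cost t (e t \<omega>) (u t \<omega>)))"

definition optimal1 :: "(nat \<Rightarrow> 'a \<Rightarrow> real^'m) \<Rightarrow> bool" where
  "optimal1 u \<longleftrightarrow> attains_infimum J_risk feasible u"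

definition optimal2 :: "(nat \<Rightarrow> 'a \<Rightarrow> real^'m) \<Rightarrow> bool" where
  "optimal2 u \<longleftrightarrow> attains_infimum (\<lambda>u. J_aug (eta u) u) feasible u"

definition optimal3 :: "(nat \<Rightarrow> 'a \<Rightarrow> real^'m) \<Rightarrow> bool" where
  "optimal3 u \<longleftrightarrow> attains_infimum (\<lambda>u. J_aug (eta_dyn u) u) feasible_aug u"

end

end

theory Submission
  imports Defs
begin

text \<open>
  Writing the new state as its conditional mean plus the centred noise d, the head block of the
  augmented state splits off and
  \<open>\<Delta> = 2 (q \<bullet> d) + (d \<bullet> Q\<^sub>0\<^sub>0 d - const)\<close>, where q is the first block row of Q applied to the
  augmented state with d removed.  Since q is a function of the past and d is independent of the
  past, \<open>E \<Delta>\<^sup>2 = 4 E (q \<bullet> \<Sigma> q) + 4 (E q \<bullet> \<gamma>) + const\<close>.  The extra terms of the cost c are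
  \<open>4 (y \<bullet> \<Sigma> y) + 4 (\<gamma> \<bullet> y)\<close> with \<open>y = q + Q\<^sub>0\<^sub>0 d\<close>, whose expectation has the same part depending
  on the control.  Hence the objectives of Problems 1 and 2 differ by a constant on the common
  feasible set.  Problems 2 and 3 have equal objectives because the augmented recursion reproduces
  the shifted states and both histories generate the same sigma-algebra.
\<close>

section \<open>Block vectors, outer products and attained infima\<close>

text \<open>The inner product on matrices is the entrywise (Frobenius) one, so
  \<open>(q \<bullet> d)^2\<close> equals \<open>outer q q \<bullet> outer d d\<close>. This
  separates the factor in \<open>q\<close> from the factor in \<open>d\<close>, the form in which
  independence applies.\<close>

lemma inner_outer: "outer a b \<bullet> outer c d = (a \<bullet> c) * (b \<bullet> d)"
proof -
  have "outer a b \<bullet> outer c d = (\<Sum>i\<in>UNIV. \<Sum>j\<in>UNIV. (a $ i * c $ i) * (b $ j * d $ j))"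
    by (simp add: outer_def inner_vec_def mult_ac)
  then show ?thesis by (simp add: inner_vec_def sum_product)
qed

lemma norm_outer: "norm (outer a b) = norm a * norm b"
  by (simp add: norm_eq_sqrt_inner inner_outer real_sqrt_mult)

lemma outer_mult_vec: "outer a b *v c = (b \<bullet> c) *\<^sub>R a"
  by (simp add: vec_eq_iff outer_def matrix_vector_mult_def inner_vec_def sum_distrib_left algebra_simps)

text \<open>Makes a quadratic form linear in the outer product, so that an expectation of
  \<open>outer a a\<close> can be moved past a constant matrix.\<close>

lemma outer_inner_matrix: "outer a a \<bullet> S = a \<bullet> (S *v a)"
  by (simp add: outer_def matrix_vector_mult_def inner_vec_def sum_distrib_left algebra_simps)

lemma continuous_on_outer [continuous_intros]:
  assumes "continuous_on S f" "continuous_on S g"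
  shows "continuous_on S (\<lambda>x. outer (f x) (g x))"
  unfolding outer_def using assms by (intro continuous_intros)

lemma borel_measurable_outer [measurable]:
  assumes [measurable]: "f \<in> borel_measurable F" "g \<in> borel_measurable F"
  shows "(\<lambda>x. outer (f x) (g x)) \<in> borel_measurable F"
proof -
  have "(\<lambda>p::(real^'b) \<times> (real^'b). outer (fst p) (snd p)) \<in> borel_measurable borel"
    by (intro borel_measurable_continuous_onI continuous_intros)
  then have [measurable]: "(\<lambda>p::(real^'b) \<times> (real^'b). outer (fst p) (snd p)) \<in> borel_measurable (borel \<Otimes>\<^sub>M borel)"
    by (simp add: borel_prod)
  have "(\<lambda>x. (\<lambda>p. outer (fst p) (snd p)) (f x, g x)) \<in> borel_measurable F"
    by measurable
  then show ?thesis by simp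
qed

lemma borel_measurable_matrix_vector_mult [measurable]:
  fixes P :: "real^'b^'c"
  assumes "f \<in> borel_measurable F"
  shows "(\<lambda>x. P *v f x) \<in> borel_measurable F"
  by (rule borel_measurable_continuous_on[OF _ assms]) (intro continuous_intros)

lemma norm_matrix_vector_mult_le:
  fixes P :: "real^'b^'c"
  obtains K where "K > 0" "\<And>v. norm (P *v v) \<le> K * norm v"
proof -
  have "bounded_linear ((*v) P)" by (rule matrix_vector_mul_bounded_linear)
  then obtain K where "K > 0" "\<forall>v. norm (P *v v) \<le> norm v * K"
    using bounded_linear.pos_bounded by blast
  then show ?thesis by (intro that[of K]) (auto simp: mult.commute)
qed

text \<open>A change of block 0 is seen only through block row 0 and block column 0 of
  \<open>P\<close>. The row and column contributions agree by symmetry, whence the factor 2.\<close>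

lemma block_quad_perturb_head:
  assumes sym: "\<And>i j. i \<le> p \<Longrightarrow> j \<le> p \<Longrightarrow> transpose (P i j) = P j i"
    and head: "e 0 = v 0 + d" and tail: "\<And>i. 0 < i \<Longrightarrow> i \<le> p \<Longrightarrow> e i = v i"
  shows "block_quad p P e =
    block_quad p P v + 2 * (d \<bullet> (\<Sum>j\<le>p. P 0 j *v v j)) + d \<bullet> (P 0 0 *v d)"
proof -
  \<comment> \<open>The perturbation padded with zero blocks, so that the bilinear expansion of
    \<open>v + b\<close> applies.\<close>
  define b where "b i = (if i = 0 then d else 0)" for i :: nat
  have e: "e i = v i + b i" if "i \<le> p" for i
    using head tail that by (auto simp: b_def)
  have bl: "(\<Sum>i\<le>p. b i \<bullet> f i) = d \<bullet> f 0" for f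
    by (subst sum.remove[of _ 0]) (auto simp: b_def intro!: sum.neutral)
  have br: "(\<Sum>j\<le>p. P i j *v b j) = P i 0 *v d" for i
    by (subst sum.remove[of _ 0]) (auto simp: b_def intro!: sum.neutral)
  have sw: "v i \<bullet> (P i 0 *v d) = d \<bullet> (P 0 i *v v i)" if "i \<le> p" for i
    using sym[of i 0] that
    by (metis dot_lmul_matrix inner_commute le0 transpose_matrix_vector)
  have "block_quad p P e = (\<Sum>i\<le>p. (v i + b i) \<bullet> (\<Sum>j\<le>p. P i j *v v j + P i j *v b j))"
    unfolding block_quad_def by (intro sum.cong refl arg_cong2[where f="(\<bullet>)"])
      (auto simp: e matrix_vector_right_distrib)
  also have "\<dots> = block_quad p P v + d \<bullet> (\<Sum>j\<le>p. P 0 j *v v j)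
      + (\<Sum>i\<le>p. v i \<bullet> (P i 0 *v d)) + d \<bullet> (P 0 0 *v d)"
    by (simp add: sum.distrib br inner_add_left inner_add_right bl block_quad_def)
  also have "(\<Sum>i\<le>p. v i \<bullet> (P i 0 *v d)) = d \<bullet> (\<Sum>j\<le>p. P 0 j *v v j)"
    by (simp add: inner_sum_right sw)
  finally show ?thesis by simp
qed

text \<open>Lets a single fourth moment dominate all moments of lower order.\<close>

lemma power_le_one_plus_power4:
  assumes "i \<le> 4" "(0::real) \<le> a" shows "a ^ i \<le> 1 + a ^ 4"
proof (cases "a \<le> 1")
  case True then show ?thesis using assms power_le_one[of a i] zero_le_power[of a 4] by linarith
next
  case False then show ?thesis using assms power_increasing[of i 4 a] by linarith
qed

text \<open>Replaces the infimum in \<open>ereal\<close> by comparisons of real values, which are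
  visibly unaffected when a constant is added to \<open>J\<close>.\<close>

lemma attains_infimum_iff:
  "attains_infimum J S p \<longleftrightarrow> p \<in> S \<and> (\<forall>q\<in>S. J p \<le> J q)"
proof
  assume a: "attains_infimum J S p"
  have "ereal (J p) \<le> ereal (J q)" if "q \<in> S" for q
    using a that unfolding attains_infimum_def by (metis INF_lower)
  then show "p \<in> S \<and> (\<forall>q\<in>S. J p \<le> J q)"
    using a by (auto simp: attains_infimum_def)
next
  assume a: "p \<in> S \<and> (\<forall>q\<in>S. J p \<le> J q)"
  then show "attains_infimum J S p"
    unfolding attains_infimum_def
    by (auto intro!: antisym INF_greatest INF_lower)
qed

section \<open>Square integrable random vectors\<close>

text \<open>The bound \<open>a * b \<le> a^2 + b^2\<close> gives an integrable majorant. Inner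
  products, outer products and quadratic forms of square integrable vectors are all covered.\<close>

lemma square_integrable_bilinear_integrable:
  fixes f :: "'a \<Rightarrow> 'b::euclidean_space" and g :: "'a \<Rightarrow> 'c::euclidean_space"
    and h :: "'a \<Rightarrow> 'd::{banach, second_countable_topology}"
  assumes "square_integrable M M f" "square_integrable M M g" "h \<in> borel_measurable M"
    and "\<And>x. norm (h x) \<le> C * (norm (f x) * norm (g x))"
  shows "integrable M h"
proof (rule Bochner_Integration.integrable_bound)
  \<comment> \<open>The absolute value keeps the majorant nonnegative whatever the sign of
    \<open>C\<close>.\<close>
  show "integrable M (\<lambda>x. \<bar>C\<bar> * ((norm (f x))\<^sup>2 + (norm (g x))\<^sup>2))"
    using assms(1,2) by (auto simp: square_integrable_def)
  show "AE x in M. norm (h x) \<le> norm (\<bar>C\<bar> * ((norm (f x))\<^sup>2 + (norm (g x))\<^sup>2))"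
  proof (rule AE_I2)
    fix x
    have "2 * (norm (f x) * norm (g x)) \<le> (norm (f x))\<^sup>2 + (norm (g x))\<^sup>2"
      using sum_squares_bound[of "norm (f x)" "norm (g x)"] by simp
    then have "norm (f x) * norm (g x) \<le> (norm (f x))\<^sup>2 + (norm (g x))\<^sup>2"
      using mult_nonneg_nonneg[OF norm_ge_zero norm_ge_zero, of "f x" "g x"] by linarith
    then have "\<bar>C\<bar> * (norm (f x) * norm (g x)) \<le> \<bar>C\<bar> * ((norm (f x))\<^sup>2 + (norm (g x))\<^sup>2)"
      by (rule mult_left_mono) simp
    moreover have "C * (norm (f x) * norm (g x)) \<le> \<bar>C\<bar> * (norm (f x) * norm (g x))"
      by (rule mult_right_mono) auto
    ultimately have "norm (h x) \<le> \<bar>C\<bar> * ((norm (f x))\<^sup>2 + (norm (g x))\<^sup>2)"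
      using assms(4)[of x] by linarith
    then show "norm (h x) \<le> norm (\<bar>C\<bar> * ((norm (f x))\<^sup>2 + (norm (g x))\<^sup>2))" by simp
  qed
qed fact

lemma square_integrable_add:
  assumes f: "square_integrable M M f" and g: "square_integrable M M g"
  shows "square_integrable M M (\<lambda>x. f x + g x)"
  unfolding square_integrable_def
proof
  have [measurable]: "f \<in> borel_measurable M" "g \<in> borel_measurable M"
    using f g by (auto simp: square_integrable_def)
  show "(\<lambda>x. f x + g x) \<in> borel_measurable M" by measurable
  have "integrable M (\<lambda>x. 2 * ((norm (f x))\<^sup>2 + (norm (g x))\<^sup>2))"
    using f g by (auto simp: square_integrable_def)
  then show "integrable M (\<lambda>x. (norm (f x + g x))\<^sup>2)"
  proof (rule Bochner_Integration.integrable_bound)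
    show "AE x in M. norm ((norm (f x + g x))\<^sup>2) \<le> norm (2 * ((norm (f x))\<^sup>2 + (norm (g x))\<^sup>2))"
    proof (rule AE_I2)
      fix x
      have "(norm (f x + g x))\<^sup>2 \<le> (norm (f x) + norm (g x))\<^sup>2"
        by (intro power_mono norm_triangle_ineq norm_ge_zero)
      also have "\<dots> \<le> 2 * ((norm (f x))\<^sup>2 + (norm (g x))\<^sup>2)"
        using sum_squares_bound[of "norm (f x)" "norm (g x)"] by (simp add: power2_sum)
      finally show "norm ((norm (f x + g x))\<^sup>2) \<le> norm (2 * ((norm (f x))\<^sup>2 + (norm (g x))\<^sup>2))"
        by simp
    qed
  qed measurable
qed

lemma square_integrable_mult_vec:
  fixes P :: "real^'b^'c"
  assumes f: "square_integrable M M f"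
  shows "square_integrable M M (\<lambda>x. P *v f x)"
  unfolding square_integrable_def
proof
  have [measurable]: "f \<in> borel_measurable M" using f by (auto simp: square_integrable_def)
  show m[measurable]: "(\<lambda>x. P *v f x) \<in> borel_measurable M" by measurable
  obtain K where K: "K > 0" "\<And>v. norm (P *v v) \<le> K * norm v" using norm_matrix_vector_mult_le[of P] by blast
  show "integrable M (\<lambda>x. (norm (P *v f x))\<^sup>2)"
  proof (rule square_integrable_bilinear_integrable[OF f f, where C="K^2"])
    show "norm ((norm (P *v f x))\<^sup>2) \<le> K^2 * (norm (f x) * norm (f x))" for x
      using power_mono[OF K(2)[of "f x"], of 2] by (simp add: power2_eq_square mult_ac)
  qed measurable
qed

lemma square_integrable_sum:
  assumes "finite I" "\<And>i. i \<in> I \<Longrightarrow> square_integrable M M (f i)"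
  shows "square_integrable M M (\<lambda>x. \<Sum>i\<in>I. f i x)"
  using assms
proof (induction I)
  case empty
  show ?case by (simp add: square_integrable_def)
next
  case (insert i I)
  then show ?case by (auto intro!: square_integrable_add)
qed

lemma (in finite_measure) square_integrable_const: "square_integrable M M (\<lambda>_. c)"
  by (simp add: square_integrable_def)

text \<open>The constant 1 is square integrable for a finite measure, so \<open>f\<close> is
  dominated by a product of two square integrable functions.\<close>

lemma (in finite_measure) square_integrable_imp_integrable:
  assumes "square_integrable M M f" shows "integrable M f"
  by (rule square_integrable_bilinear_integrable[OF assms square_integrable_const[of "1::real"], of _ 1])
     (use assms in \<open>auto simp: square_integrable_def\<close>)

lemma square_integrable_inner_mult_vec_integrable:
  fixes P :: "real^'b^'c"
  assumes "square_integrable M M f" "square_integrable M M g"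
  shows "integrable M (\<lambda>x. f x \<bullet> (P *v g x))"
proof -
  note g = square_integrable_mult_vec[OF assms(2), of P]
  have [measurable]: "f \<in> borel_measurable M" "g \<in> borel_measurable M"
    using assms by (auto simp: square_integrable_def)
  show ?thesis
    by (rule square_integrable_bilinear_integrable[OF assms(1) g, where C=1])
       (auto simp: Cauchy_Schwarz_ineq2)
qed

lemma block_quad_integrable:
  assumes "\<And>i. i \<le> p \<Longrightarrow> square_integrable M M (\<lambda>x. e x i)"
  shows "integrable M (\<lambda>x. block_quad p P (e x))"
  unfolding block_quad_def inner_sum_right
  by (intro Bochner_Integration.integrable_sum square_integrable_inner_mult_vec_integrable)
     (use assms in auto)

section \<open>Noise\<close>

context coupled_lq
begin

lemma X0_measurable [measurable]: "X0 \<in> borel_measurable M"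
proof -
  have "case_nat X0 w 0 \<in> borel_measurable M"
    using indep unfolding indep_vars_def2 by blast
  then show ?thesis by simp
qed

lemma w_measurable [measurable]:
  assumes "t < N" shows "w t \<in> borel_measurable M"
proof -
  have "case_nat X0 w (Suc t) \<in> borel_measurable M"
    using indep assms unfolding indep_vars_def2 by (metis Suc_leI atMost_iff)
  then show ?thesis by simp
qed

text \<open>\<open>case_nat X0 w\<close> has \<open>X0\<close> at index 0 and \<open>w s\<close> at
  index \<open>Suc s\<close>, so this sigma-algebra contains the initial state and the noises
  strictly before \<open>t\<close>. Unlike the history it does not depend on the control, so the
  independence assumption speaks about it directly.\<close>

definition noise_algebra :: "nat \<Rightarrow> 'a measure" where
  "noise_algebra t = vimage_algebra (space M) (\<lambda>\<omega>. \<lambda>i\<in>{..t}. case_nat X0 w i \<omega>) (PiM {..t} (\<lambda>_. borel))"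

lemma noise_measurable: "i \<le> t \<Longrightarrow> case_nat X0 w i \<in> borel_measurable (noise_algebra t)"
proof -
  assume i: "i \<le> t"
  have "(\<lambda>\<omega>. \<lambda>i\<in>{..t}. case_nat X0 w i \<omega>) \<in> measurable (noise_algebra t) (PiM {..t} (\<lambda>_. borel))"
    unfolding noise_algebra_def by (rule measurable_vimage_algebra1) (auto simp: space_PiM)
  then have "(\<lambda>\<omega>. (\<lambda>i\<in>{..t}. case_nat X0 w i \<omega>) i) \<in> borel_measurable (noise_algebra t)"
    by (rule measurable_compose) (use i in \<open>auto intro: measurable_component_singleton\<close>)
  then show ?thesis using i by simp
qed

text \<open>\<open>w t\<close> has index \<open>Suc t\<close> in the independent family, outside the
  index set \<open>{..t}\<close> behind \<open>noise_algebra t\<close>. The two groups of variables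
  are therefore independent, and independence passes to the smaller sigma-algebras generated by
  \<open>Y\<close> and \<open>g (w t)\<close>.\<close>

lemma noise_algebra_indep:
  assumes Y: "Y \<in> measurable (noise_algebra t) K" and t: "t < N"
    and g: "g \<in> measurable borel L"
  shows "indep_var K Y L (\<lambda>\<omega>. g (w t \<omega>))"
proof -
  let ?noise = "\<lambda>I \<omega>. \<lambda>i\<in>I. case_nat X0 w i \<omega>"
  let ?sig = "\<lambda>I. vimage_algebra (space M) (?noise I) (PiM I (\<lambda>_. borel))"
  have space: "?noise I \<in> space M \<rightarrow> space (PiM I (\<lambda>_. borel :: (real^'n) measure))" for I
    by (auto simp: space_PiM)
  have i: "indep_var (PiM {..t} (\<lambda>_. borel)) (?noise {..t}) (PiM {Suc t} (\<lambda>_. borel)) (?noise {Suc t})"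
    by (rule indep_var_restrict[OF indep]) (use t in auto)
  then have ind: "indep_set (sets (?sig {..t})) (sets (?sig {Suc t}))"
    by (simp add: indep_var_eq sets_vimage_algebra)
  have "?noise {Suc t} \<in> measurable (?sig {Suc t}) (PiM {Suc t} (\<lambda>_. borel))"
    by (rule measurable_vimage_algebra1[OF space])
  then have "(\<lambda>\<omega>. g (?noise {Suc t} \<omega> (Suc t))) \<in> measurable (?sig {Suc t}) L"
    using g by measurable
  then have Z: "(\<lambda>\<omega>. g (w t \<omega>)) \<in> measurable (?sig {Suc t}) L" by simp
  have sub: "sigma_sets (space M) {X -` A \<inter> space M | A. A \<in> sets S} \<subseteq> sets (?sig I)"
    if "X \<in> measurable (?sig I) S" for X I and S :: "'z measure"
    using sets_image_in_sets[of "?sig I" "space M" X S] that by (simp add: sets_vimage_algebra)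
  have "?noise {..t} \<in> measurable M (PiM {..t} (\<lambda>_. borel))"
    using i unfolding indep_var_eq by blast
  then have "subalgebra M (noise_algebra t)"
    unfolding subalgebra_def noise_algebra_def by (simp add: sets_image_in_sets)
  then have YM: "Y \<in> measurable M K"
    using Y by (rule measurable_from_subalg)
  show ?thesis
    unfolding indep_var_eq
  proof (intro conjI YM)
    show "random_variable L (\<lambda>\<omega>. g (w t \<omega>))"
      by (rule measurable_compose[OF w_measurable[OF t] g])
    show "indep_set (sigma_sets (space M) {Y -` A \<inter> space M | A. A \<in> sets K})
        (sigma_sets (space M) {(\<lambda>\<omega>. g (w t \<omega>)) -` A \<inter> space M | A. A \<in> sets L})"
      using ind sub[OF Z] sub[OF Y[unfolded noise_algebra_def]] unfolding indep_set_def
      by (elim indep_sets_mono_sets) (auto split: bool.split)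
  qed
qed

text \<open>Expanding in \<open>Basis\<close> reduces the claim to products of independent real
  variables. The general Euclidean type serves scalars, vectors and, with the Frobenius product,
  matrices.\<close>

lemma noise_algebra_expectation_inner:
  fixes Y :: "'a \<Rightarrow> 'b::euclidean_space"
  assumes Y: "Y \<in> borel_measurable (noise_algebra t)" "integrable M Y" and t: "t < N"
    and g: "g \<in> borel_measurable borel" "integrable M (\<lambda>\<omega>. g (w t \<omega>))"
  shows "integrable M (\<lambda>\<omega>. Y \<omega> \<bullet> g (w t \<omega>))"
    and "expectation (\<lambda>\<omega>. Y \<omega> \<bullet> g (w t \<omega>)) = expectation Y \<bullet> expectation (\<lambda>\<omega>. g (w t \<omega>))"
proof -
  have ind: "indep_var borel (\<lambda>\<omega>. Y \<omega> \<bullet> b) borel (\<lambda>\<omega>. g (w t \<omega>) \<bullet> b)" for b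
    by (rule noise_algebra_indep[where g="\<lambda>v. g v \<bullet> b"]) (use Y g t in \<open>auto\<close>)
  have int: "integrable M (\<lambda>\<omega>. Y \<omega> \<bullet> b)" "integrable M (\<lambda>\<omega>. g (w t \<omega>) \<bullet> b)" for b
    using Y g by auto
  note prod = indep_var_integrable[OF ind int] indep_var_lebesgue_integral[OF ind int]
  have eq: "Y \<omega> \<bullet> g (w t \<omega>) = (\<Sum>b\<in>Basis. (Y \<omega> \<bullet> b) * (g (w t \<omega>) \<bullet> b))" for \<omega>
    by (rule euclidean_inner)
  show "integrable M (\<lambda>\<omega>. Y \<omega> \<bullet> g (w t \<omega>))"
    unfolding eq using prod(1) by auto
  have "expectation (\<lambda>\<omega>. Y \<omega> \<bullet> g (w t \<omega>)) =
     (\<Sum>b\<in>Basis. expectation (\<lambda>\<omega>. Y \<omega> \<bullet> b) * expectation (\<lambda>\<omega>. g (w t \<omega>) \<bullet> b))"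
    unfolding eq using prod by (subst Bochner_Integration.integral_sum) auto
  also have "\<dots> = expectation Y \<bullet> expectation (\<lambda>\<omega>. g (w t \<omega>))"
    using Y g by (subst euclidean_inner[of "expectation Y"]) simp
  finally show "expectation (\<lambda>\<omega>. Y \<omega> \<bullet> g (w t \<omega>)) = expectation Y \<bullet> expectation (\<lambda>\<omega>. g (w t \<omega>))" .
qed

text \<open>The index is that of the noise, so \<open>dev t\<close> is the vector called d with
  index t + 1 in the problem.\<close>

definition dev :: "nat \<Rightarrow> 'a \<Rightarrow> real^'n" where
  "dev t \<omega> = w t \<omega> - noise_mean"

lemma dev_measurable [measurable]: "t < N \<Longrightarrow> dev t \<in> borel_measurable M"
  unfolding dev_def by measurable

lemma noise_dev_eq: "noise_dev = dev 0"
  by (auto simp: noise_dev_def dev_def)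

text \<open>Both sides integrate the same function against the common law of the noises. This is how
  the hypothesis \<open>ident_distr\<close> enters.\<close>

lemma expectation_dev_eq:
  fixes g :: "real^'n \<Rightarrow> 'b::{banach, second_countable_topology}"
  assumes t: "t < N" and [measurable]: "g \<in> borel_measurable borel"
  shows "expectation (\<lambda>\<omega>. g (dev t \<omega>)) = expectation (\<lambda>\<omega>. g (noise_dev \<omega>))"
proof -
  have *: "expectation (\<lambda>\<omega>. g (dev s \<omega>)) = integral\<^sup>L (distr M borel (w s)) (\<lambda>v. g (v - noise_mean))" if "s < N" for s
    unfolding dev_def using that by (subst integral_distr) auto
  show ?thesis using *[OF t] *[of 0] ident_distr[OF t] N_pos by (simp add: noise_dev_eq)
qed

text \<open>Growth of at most fourth order suffices, because centring by a fixed vector preserves a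
  finite fourth moment.\<close>

lemma dev_integrable:
  fixes g :: "real^'n \<Rightarrow> 'b::{banach, second_countable_topology}"
  assumes t: "t < N" and [measurable]: "g \<in> borel_measurable borel"
    and bd: "\<And>v. norm (g v) \<le> C * (1 + norm v ^ 4)"
  shows "integrable M (\<lambda>\<omega>. g (dev t \<omega>))"
proof (rule Bochner_Integration.integrable_bound)
  let ?m = "norm noise_mean"
  show "integrable M (\<lambda>\<omega>. \<bar>C\<bar> * (1 + 8 * (norm (w t \<omega>) ^ 4 + ?m ^ 4)))"
    using fourth_moment[OF t] by auto
  show "(\<lambda>\<omega>. g (dev t \<omega>)) \<in> borel_measurable M" using t by measurable
  \<comment> \<open>The bound \<open>(a + b)^2 \<le> 2 * (a^2 + b^2)\<close> is used twice, the
    second time for the squares, which yields 8.\<close>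
  have quart: "(a + b) ^ 4 \<le> 8 * (a ^ 4 + b ^ 4)" for a b :: real
  proof -
    have "(a + b) ^ 4 = ((a + b)\<^sup>2)\<^sup>2" by simp
    also have "\<dots> \<le> (2 * (a\<^sup>2 + b\<^sup>2))\<^sup>2"
    proof (rule power_mono[OF _ zero_le_power2])
      show "(a + b)\<^sup>2 \<le> 2 * (a\<^sup>2 + b\<^sup>2)"
        using sum_squares_bound[of a b] by (simp add: power2_sum)
    qed
    also have "\<dots> = 4 * ((a\<^sup>2)\<^sup>2 + (b\<^sup>2)\<^sup>2) + 4 * (2 * a\<^sup>2 * b\<^sup>2)"
      by (simp add: power2_eq_square algebra_simps)
    also have "\<dots> \<le> 4 * ((a\<^sup>2)\<^sup>2 + (b\<^sup>2)\<^sup>2) + 4 * ((a\<^sup>2)\<^sup>2 + (b\<^sup>2)\<^sup>2)"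
      by (intro add_left_mono mult_left_mono sum_squares_bound) simp
    finally show ?thesis by simp
  qed
  show "AE \<omega> in M. norm (g (dev t \<omega>)) \<le> norm (\<bar>C\<bar> * (1 + 8 * (norm (w t \<omega>) ^ 4 + ?m ^ 4)))"
  proof (rule AE_I2)
    fix \<omega>
    have "norm (dev t \<omega>) ^ 4 \<le> (norm (w t \<omega>) + ?m) ^ 4"
      unfolding dev_def by (intro power_mono norm_triangle_ineq4 norm_ge_zero)
    also note quart
    finally have "1 + norm (dev t \<omega>) ^ 4 \<le> 1 + 8 * (norm (w t \<omega>) ^ 4 + ?m ^ 4)" by simp
    then have "\<bar>C\<bar> * (1 + norm (dev t \<omega>) ^ 4) \<le> \<bar>C\<bar> * (1 + 8 * (norm (w t \<omega>) ^ 4 + ?m ^ 4))"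
      by (rule mult_left_mono) simp
    moreover have "norm (g (dev t \<omega>)) \<le> \<bar>C\<bar> * (1 + norm (dev t \<omega>) ^ 4)"
      using bd[of "dev t \<omega>"] by (rule order_trans) (intro mult_right_mono, auto)
    ultimately show "norm (g (dev t \<omega>)) \<le> norm (\<bar>C\<bar> * (1 + 8 * (norm (w t \<omega>) ^ 4 + ?m ^ 4)))"
      by simp
  qed
qed

definition noise_quad :: "real^'n \<Rightarrow> real" where
  "noise_quad v = v \<bullet> (Q 0 0 *v v)"

lemma noise_quad_measurable [measurable]: "noise_quad \<in> borel_measurable borel"
  unfolding noise_quad_def by measurable

text \<open>The quadratic form \<open>noise_quad\<close> grows at most like the squared norm, so all
  these functions have at most fourth order growth. The squared deviation of
  \<open>noise_quad\<close> reaches order four.\<close>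

lemma
  assumes t: "t < N"
  shows dev_integrable_id: "integrable M (dev t)"
    and dev_integrable_outer: "integrable M (\<lambda>\<omega>. outer (dev t \<omega>) (dev t \<omega>))"
    and dev_integrable_quad: "integrable M (\<lambda>\<omega>. noise_quad (dev t \<omega>))"
    and dev_integrable_quad_sq: "integrable M (\<lambda>\<omega>. (noise_quad (dev t \<omega>) - c)\<^sup>2)"
    and dev_integrable_skew: "integrable M (\<lambda>\<omega>. noise_quad (dev t \<omega>) *\<^sub>R dev t \<omega>)"
    and dev_square_integrable: "square_integrable M M (dev t)"
proof -
  obtain K where K: "K > 0" "\<And>v. norm (Q 0 0 *v v) \<le> K * norm v"
    using norm_matrix_vector_mult_le[of "Q 0 0"] by blast
  have r: "\<bar>noise_quad v\<bar> \<le> K * norm v ^ 2" for v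
  proof -
    have "\<bar>noise_quad v\<bar> \<le> norm v * norm (Q 0 0 *v v)" 
      unfolding noise_quad_def by (rule Cauchy_Schwarz_ineq2)
    also have "\<dots> \<le> norm v * (K * norm v)" by (intro mult_left_mono K) auto
    finally show ?thesis by (simp add: power2_eq_square algebra_simps)
  qed
  note p = power_le_one_plus_power4
  show "integrable M (dev t)"
    by (rule dev_integrable[OF t, of "\<lambda>v. v" 1]) (use p[of 1] in auto)
  show "integrable M (\<lambda>\<omega>. outer (dev t \<omega>) (dev t \<omega>))"
    by (rule dev_integrable[OF t, of "\<lambda>v. outer v v" 1])
       (use p[of 2] in \<open>auto simp: norm_outer power2_eq_square\<close>)
  show "integrable M (\<lambda>\<omega>. noise_quad (dev t \<omega>))"
  proof (rule dev_integrable[OF t, of noise_quad K])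
    show "norm (noise_quad v) \<le> K * (1 + norm v ^ 4)" for v
      using order_trans[OF r[of v] mult_left_mono[OF p[of 2 "norm v"], of K]] K(1) by simp
  qed measurable
  show "integrable M (\<lambda>\<omega>. (noise_quad (dev t \<omega>) - c)\<^sup>2)"
  \<comment> \<open>The constant adds the coefficients in
    \<open>(a - c)^2 \<le> 2 * a^2 + 2 * c^2\<close> after bounding \<open>a^2\<close> by
    \<open>K^2 * norm v ^ 4\<close>.\<close>
  proof (rule dev_integrable[OF t, of "\<lambda>v. (noise_quad v - c)\<^sup>2" "2 * K\<^sup>2 + 2 * c\<^sup>2"])
    fix v :: "real^'n"
    have "(noise_quad v - c)\<^sup>2 \<le> 2 * (noise_quad v)\<^sup>2 + 2 * c\<^sup>2"
      using sum_squares_bound[of "noise_quad v" "-c"] by (simp add: power2_diff)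
    also have "(noise_quad v)\<^sup>2 \<le> (K * norm v ^ 2)\<^sup>2"
      using power_mono[OF r[of v], of 2] by simp
    also have "\<dots> = K\<^sup>2 * norm v ^ 4" by (simp add: power_mult_distrib)
    also have "2 * (K\<^sup>2 * norm v ^ 4) + 2 * c\<^sup>2 \<le> (2 * K\<^sup>2 + 2 * c\<^sup>2) * (1 + norm v ^ 4)"
      by (simp add: algebra_simps)
    finally show "norm ((noise_quad v - c)\<^sup>2) \<le> (2 * K\<^sup>2 + 2 * c\<^sup>2) * (1 + norm v ^ 4)" by simp
  qed measurable
  show "integrable M (\<lambda>\<omega>. noise_quad (dev t \<omega>) *\<^sub>R dev t \<omega>)"
  proof (rule dev_integrable[OF t, of "\<lambda>v. noise_quad v *\<^sub>R v" K])
    fix v :: "real^'n"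
    have "\<bar>noise_quad v\<bar> * norm v \<le> K * norm v ^ 2 * norm v"
      by (intro mult_right_mono r) auto
    also have "\<dots> = K * norm v ^ 3" by (simp add: power2_eq_square power3_eq_cube)
    also have "\<dots> \<le> K * (1 + norm v ^ 4)" using K p[of 3 "norm v"] by (intro mult_left_mono) auto
    finally show "norm (noise_quad v *\<^sub>R v) \<le> K * (1 + norm v ^ 4)" by simp
  qed measurable
  have "integrable M (\<lambda>\<omega>. (norm (dev t \<omega>))\<^sup>2)"
    by (rule dev_integrable[OF t, of "\<lambda>v. (norm v)\<^sup>2" 1]) (use p[of 2] in auto)
  then show "square_integrable M M (dev t)" using t by (simp add: square_integrable_def)
qed

lemma expectation_dev: "t < N \<Longrightarrow> expectation (dev t) = 0"
proof -
  assume t: "t < N"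
  have N: "0 < N" using N_pos by simp
  have "w 0 = (\<lambda>\<omega>. dev 0 \<omega> + noise_mean)" by (simp add: dev_def)
  then have "integrable M (w 0)" using dev_integrable_id[OF N] by auto
  then have "expectation (dev 0) = 0" by (simp add: dev_def[abs_def] noise_mean_def prob_space)
  then show ?thesis using expectation_dev_eq[OF t, of "\<lambda>v. v"] by (simp add: noise_dev_eq)
qed

lemma expectation_mult_vec_dev:
  fixes P :: "real^'n^'c"
  assumes "t < N" shows "expectation (\<lambda>\<omega>. P *v dev t \<omega>) = 0"
  using integral_bounded_linear[OF matrix_vector_mul_bounded_linear dev_integrable_id[OF assms], of P]
  by (simp add: expectation_dev[OF assms])

section \<open>Histories\<close>

lemma hist_measurable:
  "hist u t \<in> measurable (hist_algebra u t) (PiM {..t} (\<lambda>_. borel) \<Otimes>\<^sub>M PiM {..<t} (\<lambda>_. borel))"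
  unfolding hist_algebra_def
  by (rule measurable_vimage_algebra1) (auto simp: space_PiM space_pair_measure hist_def)

lemma hist_aug_measurable:
  "hist_aug u t \<in> measurable (hist_aug_algebra u t)
     (PiM {..t} (\<lambda>s. block_borel (lag s)) \<Otimes>\<^sub>M PiM {..<t} (\<lambda>_. borel))"
proof -
  \<comment> \<open>\<open>block_borel (lag s)\<close> is a product space, so membership requires
    the value \<open>undefined\<close> outside \<open>{..lag s}\<close>.\<close>
  have "eta_dyn u s \<omega> \<in> extensional {..lag s}" for s \<omega>
    by (cases s) (auto simp: f_aug_def lag_def)
  then show ?thesis
    unfolding hist_aug_algebra_def
    by (intro measurable_vimage_algebra1)
       (auto simp: space_PiM space_pair_measure hist_aug_def block_borel_def PiE_def)
qed

lemma state_hist_measurable: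
  assumes "s \<le> t" shows "state u s \<in> borel_measurable (hist_algebra u t)"
proof -
  have "(\<lambda>\<omega>. fst (hist u t \<omega>) s) \<in> borel_measurable (hist_algebra u t)"
    by (rule measurable_compose[OF measurable_compose[OF hist_measurable measurable_fst]
      measurable_component_singleton]) (use assms in auto)
  then show ?thesis using assms by (simp add: hist_def)
qed

lemma control_hist_measurable:
  assumes "s < t" shows "u s \<in> borel_measurable (hist_algebra u t)"
proof -
  have "(\<lambda>\<omega>. snd (hist u t \<omega>) s) \<in> borel_measurable (hist_algebra u t)"
    by (rule measurable_compose[OF measurable_compose[OF hist_measurable measurable_snd]
      measurable_component_singleton]) (use assms in auto)
  then show ?thesis using assms by (simp add: hist_def)
qed

lemma space_hist_algebra [simp]: "space (hist_algebra u t) = space M"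
  by (simp add: hist_algebra_def)

text \<open>Minimality of a generated sigma-algebra. \<open>F\<close> is only tied to
  \<open>M\<close> by its space, so the rule serves both the noise algebra and the augmented
  history.\<close>

lemma hist_algebra_subalgebraI:
  assumes "space F = space M"
    and "\<And>s. s \<le> t \<Longrightarrow> state u s \<in> borel_measurable F"
    and "\<And>s. s < t \<Longrightarrow> u s \<in> borel_measurable F"
  shows "subalgebra F (hist_algebra u t)"
proof -
  have "hist u t \<in> measurable F (PiM {..t} (\<lambda>_. borel) \<Otimes>\<^sub>M PiM {..<t} (\<lambda>_. borel))"
    unfolding hist_def[abs_def]
    by (intro measurable_Pair measurable_restrict) (simp_all add: assms(2,3))
  then have "sets (hist_algebra u t) \<subseteq> sets F"
    unfolding hist_algebra_def using assms(1) by (intro sets_image_in_sets)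
  then show ?thesis using assms(1) by (simp add: subalgebra_def)
qed

lemma space_hist_aug_algebra [simp]: "space (hist_aug_algebra u t) = space M"
  by (simp add: hist_aug_algebra_def)

lemma space_noise_algebra [simp]: "space (noise_algebra t) = space M"
  by (simp add: noise_algebra_def)

text \<open>Row 0 of the augmented dynamics is the state equation, and row \<open>Suc i'\<close>
  copies block \<open>i'\<close>, which holds the state at time
  \<open>t - i' = Suc t - Suc i'\<close>.\<close>

lemma eta_dyn_eq_eta: "eta_dyn u t \<omega> = eta u t \<omega>"
proof (induction t)
  case 0
  show ?case by (auto simp: eta_def lag_def)
next
  case (Suc t)
  have "f_aug t (eta u t \<omega>) (u t \<omega>) (w t \<omega>) i = eta u (Suc t) \<omega> i" for i
  proof (cases "i \<le> lag (Suc t)")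
    case False
    then show ?thesis by (simp add: f_aug_def eta_def)
  next
    case True
    show ?thesis
    proof (cases i)
      case 0
      have "(\<Sum>j\<le>lag t. A_aug 0 j *v eta u t \<omega> j) = A *v state u t \<omega>"
        by (subst sum.remove[of _ 0]) (auto simp: A_aug_def eta_def intro!: sum.neutral)
      then show ?thesis using 0 by (simp add: f_aug_def eta_def B_aug_def C_aug_def)
    next
      case (Suc i')
      \<comment> \<open>Since \<open>lag (Suc t) \<le> Suc (lag t)\<close>, the block to be copied
        is present at time \<open>t\<close>.\<close>
      then have i': "i' \<le> lag t" using True by (auto simp: lag_def)
      have "(\<Sum>j\<le>lag t. A_aug i j *v eta u t \<omega> j) = state u (t - i') \<omega>"
        using i' Suc by (subst sum.remove[of _ i']) (auto simp: A_aug_def eta_def intro!: sum.neutral)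
      then show ?thesis using Suc True by (simp add: f_aug_def eta_def B_aug_def C_aug_def)
    qed
  qed
  then show ?case using Suc by auto
qed

lemma eta_hist_measurable:
  assumes "s \<le> t" shows "eta u s \<in> measurable (hist_algebra u t) (block_borel (lag s))"
  unfolding block_borel_def eta_def[abs_def]
  by (intro measurable_restrict state_hist_measurable) (use assms in auto)

text \<open>The augmented vectors up to time \<open>t\<close> consist of states up to time
  \<open>t\<close>; conversely block 0 of each of them is the state at that time. The controls are
  recorded in both histories.\<close>

lemma sets_hist_aug_algebra: "sets (hist_aug_algebra u t) = sets (hist_algebra u t)"
proof
  have "hist_aug u t \<in> measurable (hist_algebra u t)
      (PiM {..t} (\<lambda>s. block_borel (lag s)) \<Otimes>\<^sub>M PiM {..<t} (\<lambda>_. borel))"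
    unfolding hist_aug_def[abs_def] eta_dyn_eq_eta
    by (intro measurable_Pair measurable_restrict eta_hist_measurable control_hist_measurable) auto
  then show "sets (hist_aug_algebra u t) \<subseteq> sets (hist_algebra u t)"
    unfolding hist_aug_algebra_def by (intro sets_image_in_sets) auto
  have "subalgebra (hist_aug_algebra u t) (hist_algebra u t)"
  proof (rule hist_algebra_subalgebraI)
    fix s assume s: "s \<le> t"
    have "(\<lambda>\<omega>. fst (hist_aug u t \<omega>) s) \<in> measurable (hist_aug_algebra u t) (block_borel (lag s))"
      by (rule measurable_compose[OF measurable_compose[OF hist_aug_measurable measurable_fst]
        measurable_component_singleton]) (use s in auto)
    then have "(\<lambda>\<omega>. fst (hist_aug u t \<omega>) s 0) \<in> borel_measurable (hist_aug_algebra u t)"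
      unfolding block_borel_def
      by (rule measurable_compose[OF _ measurable_component_singleton]) auto
    then show "state u s \<in> borel_measurable (hist_aug_algebra u t)"
      using s by (simp add: hist_aug_def eta_dyn_eq_eta eta_def)
  next
    fix s assume s: "s < t"
    have "(\<lambda>\<omega>. snd (hist_aug u t \<omega>) s) \<in> borel_measurable (hist_aug_algebra u t)"
      by (rule measurable_compose[OF measurable_compose[OF hist_aug_measurable measurable_snd]
        measurable_component_singleton]) (use s in auto)
    then show "u s \<in> borel_measurable (hist_aug_algebra u t)"
      using s by (simp add: hist_aug_def)
  qed simp
  then show "sets (hist_algebra u t) \<subseteq> sets (hist_aug_algebra u t)"
    by (simp add: subalgebra_def)
qed

lemma feasible_aug_eq: "feasible_aug = feasible"
  unfolding feasible_aug_def feasible_def square_integrable_def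
  by (simp add: measurable_cong_sets[OF sets_hist_aug_algebra refl])

section \<open>Adaptedness of states and controls to the noise, and square integrability\<close>

lemma noise_subalgebra:
  assumes "t \<le> N" shows "subalgebra M (noise_algebra t)"
proof -
  have "(\<lambda>\<omega>. \<lambda>i\<in>{..t}. case_nat X0 w i \<omega>) \<in> measurable M (PiM {..t} (\<lambda>_. borel))"
    using indep assms unfolding indep_vars_def2 by (intro measurable_restrict) auto
  then have "sets (noise_algebra t) \<subseteq> sets M"
    unfolding noise_algebra_def by (intro sets_image_in_sets) auto
  then show ?thesis by (simp add: subalgebra_def)
qed

lemma noise_algebra_mono:
  assumes "s \<le> t" shows "subalgebra (noise_algebra t) (noise_algebra s)"
proof -
  have "sets (noise_algebra s) \<subseteq> sets (noise_algebra t)"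
    unfolding noise_algebra_def[of s]
    by (intro sets_image_in_sets measurable_restrict noise_measurable) (use assms in auto)
  then show ?thesis by (simp add: subalgebra_def)
qed

text \<open>A feasible control is a function of its own history, so unrolling the recursion
  expresses states up to \<open>t\<close> and controls before \<open>t\<close> through the initial
  state and the noises before \<open>t\<close>. Through this inclusion the history inherits
  independence from \<open>w t\<close>.\<close>

lemma hist_noise_subalgebra:
  assumes u: "u \<in> feasible" and t: "t \<le> N"
  shows "subalgebra (noise_algebra t) (hist_algebra u t)"
proof -
  have "(\<forall>s\<le>t. state u s \<in> borel_measurable (noise_algebra t)) \<and>
    (\<forall>s<t. u s \<in> borel_measurable (noise_algebra t))"
    using t
  proof (induction t)
    case 0
    have "X0 \<in> borel_measurable (noise_algebra 0)" using noise_measurable[of 0 0] by simp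
    then show ?case by simp
  next
    case (Suc t)
    note IH = Suc.IH[OF Suc_leD[OF Suc.prems]]
    have mono: "f \<in> borel_measurable (noise_algebra (Suc t))"
      if "f \<in> borel_measurable (noise_algebra t)" for f :: "'a \<Rightarrow> real^'c"
      by (rule measurable_from_subalg[OF noise_algebra_mono that]) simp
    \<comment> \<open>The induction hypothesis places the whole history at \<open>t\<close> inside
      the noise algebra, so feasibility also places \<open>u t\<close> there.\<close>
    have "subalgebra (noise_algebra t) (hist_algebra u t)"
      using IH by (intro hist_algebra_subalgebraI) auto
    moreover have "u t \<in> borel_measurable (hist_algebra u t)"
      using u Suc.prems by (auto simp: feasible_def square_integrable_def)
    ultimately have ut: "u t \<in> borel_measurable (noise_algebra (Suc t))"
      by (intro mono) (rule measurable_from_subalg)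
    have [measurable]: "w t \<in> borel_measurable (noise_algebra (Suc t))"
      using noise_measurable[of "Suc t" "Suc t"] by simp
    have [measurable]: "state u t \<in> borel_measurable (noise_algebra (Suc t))"
      using IH by (intro mono) auto
    have "(\<lambda>\<omega>. A *v state u t \<omega> + B *v u t \<omega> + w t \<omega>) \<in> borel_measurable (noise_algebra (Suc t))"
      using ut by measurable
    moreover have "state u (Suc t) = (\<lambda>\<omega>. A *v state u t \<omega> + B *v u t \<omega> + w t \<omega>)" by auto
    ultimately have xt: "state u (Suc t) \<in> borel_measurable (noise_algebra (Suc t))" by metis
    show ?case
    proof (intro conjI allI impI)
      show "state u s \<in> borel_measurable (noise_algebra (Suc t))" if "s \<le> Suc t" for s
      proof (cases "s = Suc t")
        case False
        then have "state u s \<in> borel_measurable (noise_algebra t)" using IH that by simp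
        then show ?thesis by (rule mono)
      qed (simp only: xt)
      show "u s \<in> borel_measurable (noise_algebra (Suc t))" if "s < Suc t" for s
      proof (cases "s = t")
        case False
        then have "u s \<in> borel_measurable (noise_algebra t)" using IH that by simp
        then show ?thesis by (rule mono)
      qed (simp only: ut)
    qed
  qed
  then show ?thesis
    by (intro hist_algebra_subalgebraI) auto
qed

lemma hist_subalgebra:
  assumes "u \<in> feasible" "t \<le> N" shows "subalgebra M (hist_algebra u t)"
  using hist_noise_subalgebra[OF assms] noise_subalgebra[OF assms(2)] by (auto simp: subalgebra_def)

lemma control_square_integrable:
  assumes u: "u \<in> feasible" and t: "t < N"
  shows "square_integrable M M (u t)"
  using u t measurable_from_subalg[OF hist_subalgebra[OF u, of t]]
  by (auto simp: feasible_def square_integrable_def)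

lemma state_square_integrable:
  assumes u: "u \<in> feasible" and t: "t \<le> N"
  shows "square_integrable M M (state u t)"
  using t
proof (induction t)
  case 0
  \<comment> \<open>The second moment of \<open>X0\<close> is finite because \<open>X0\<close> is
    almost surely the constant \<open>xinit\<close>.\<close>
  have "integrable M (\<lambda>\<omega>. (norm (X0 \<omega>))\<^sup>2) \<longleftrightarrow> integrable M (\<lambda>\<omega>. (norm xinit)\<^sup>2)"
    by (rule integrable_cong_AE) (use X0_AE in auto)
  moreover have "state u 0 = X0" by auto
  ultimately show ?case by (simp add: square_integrable_def)
next
  case (Suc t)
  then have t: "t < N" by simp
  have "square_integrable M M (\<lambda>\<omega>. A *v state u t \<omega> + B *v u t \<omega> + (dev t \<omega> + noise_mean))"
    using Suc t by (intro square_integrable_add square_integrable_mult_vec dev_square_integrable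
      square_integrable_const control_square_integrable[OF u]) auto
  moreover have "state u (Suc t) = (\<lambda>\<omega>. A *v state u t \<omega> + B *v u t \<omega> + (dev t \<omega> + noise_mean))"
    by (auto simp: dev_def)
  ultimately show ?case by simp
qed

lemma eta_square_integrable:
  assumes "u \<in> feasible" "t \<le> N" "i \<le> lag t"
  shows "square_integrable M M (\<lambda>\<omega>. eta u t \<omega> i)"
  using state_square_integrable[OF assms(1), of "t - i"] assms by (simp add: eta_def)

section \<open>Costs\<close>

lemma z_integrable:
  assumes "u \<in> feasible" "t \<le> N" shows "integrable M (z u t)"
  unfolding z_def[abs_def] by (intro block_quad_integrable eta_square_integrable assms)

lemma state_cost_integrable:
  assumes "u \<in> feasible" "t \<le> N" shows "integrable M (\<lambda>\<omega>. state_cost t (eta u t \<omega>))"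
  unfolding state_cost_def
  by (intro Bochner_Integration.integrable_add integrable_mult_right Bochner_Integration.integrable_sum
      integrable_inner_right block_quad_integrable square_integrable_imp_integrable eta_square_integrable assms) auto

lemma control_cost_integrable:
  assumes "u \<in> feasible" "t < N" shows "integrable M (\<lambda>\<omega>. u t \<omega> \<bullet> (R *v u t \<omega>))"
  by (intro square_integrable_inner_mult_vec_integrable control_square_integrable assms)

lemma Q_transpose: "i \<le> k \<Longrightarrow> j \<le> k \<Longrightarrow> transpose (Q i j) = Q j i"
  using Q_psd by (auto simp: block_sym_pos_semidef_def)

lemma inner_Q_swap: "i \<le> k \<Longrightarrow> a \<bullet> (Q i 0 *v b) = (Q 0 i *v a) \<bullet> b"
  by (metis Q_transpose dot_lmul_matrix le0 transpose_matrix_vector)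

text \<open>Each block of \<open>H\<close> factors as \<open>Q i 0\<close>,
  \<open>noise_cov\<close>, \<open>Q 0 j\<close>, and \<open>zeta\<close> carries the factor
  \<open>Q i 0\<close>. By symmetry of \<open>Q\<close>, the extra cost therefore depends on
  \<open>e\<close> only through its product \<open>y\<close> with the first block row.\<close>

lemma state_cost_eq:
  fixes t :: nat and e :: "nat \<Rightarrow> real^'n"
  defines "y \<equiv> \<Sum>j\<le>lag t. Q 0 j *v e j"
  shows "state_cost t e =
    block_quad (lag t) Q e + lam * (4 * (y \<bullet> (noise_cov *v y)) + 4 * (noise_skew \<bullet> y))"
proof -
  have le: "i \<le> k" if "i \<le> lag t" for i using that by (simp add: lag_def)
  have "(\<Sum>j\<le>lag t. H i j *v e j) = 4 *\<^sub>R (Q i 0 *v (noise_cov *v y))" for i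
    by (simp add: H_def y_def scaleR_sum_right linear_sum[OF matrix_vector_mul_linear]
        scaleR_matrix_vector_assoc[symmetric] matrix_vector_mul_assoc matrix_mul_assoc)
  then have "block_quad (lag t) H e = (\<Sum>i\<le>lag t. 4 * ((Q 0 i *v e i) \<bullet> (noise_cov *v y)))"
    unfolding block_quad_def by (intro sum.cong) (auto simp: inner_Q_swap le)
  also have "\<dots> = 4 * (y \<bullet> (noise_cov *v y))"
    by (simp add: y_def inner_sum_left sum_distrib_left)
  finally have H: "block_quad (lag t) H e = 4 * (y \<bullet> (noise_cov *v y))" .
  have "(\<Sum>i\<le>lag t. zeta i \<bullet> e i) = (\<Sum>i\<le>lag t. 4 * (noise_skew \<bullet> (Q 0 i *v e i)))"
    unfolding zeta_def by (intro sum.cong) (auto simp: inner_Q_swap le inner_commute)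
  also have "\<dots> = 4 * (noise_skew \<bullet> y)"
    by (simp add: y_def inner_sum_right sum_distrib_left)
  finally have Z: "(\<Sum>i\<le>lag t. zeta i \<bullet> e i) = 4 * (noise_skew \<bullet> y)" .
  have "block_quad (lag t) Q_lam e = block_quad (lag t) Q e + lam * block_quad (lag t) H e"
    by (simp add: block_quad_def Q_lam_def matrix_vector_mult_add_rdistrib sum.distrib
        inner_add_right scaleR_matrix_vector_assoc[symmetric] scaleR_sum_right[symmetric]
        sum_distrib_left)
  then show ?thesis by (simp add: state_cost_def H Z algebra_simps)
qed

definition noise_quad_mean :: real where
  "noise_quad_mean = expectation (\<lambda>\<omega>. noise_quad (noise_dev \<omega>))"

definition noise_quad_var :: real where
  "noise_quad_var = expectation (\<lambda>\<omega>. (noise_quad (noise_dev \<omega>) - noise_quad_mean)\<^sup>2)"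

text \<open>The contribution of the current noise alone to the quadratic extra cost; it is the same
  for all controls and times.\<close>

definition noise_cov_offset :: real where
  "noise_cov_offset = expectation (\<lambda>\<omega>. (Q 0 0 *v noise_dev \<omega>) \<bullet> (noise_cov *v (Q 0 0 *v noise_dev \<omega>)))"

section \<open>One transition from \<open>t\<close> to \<open>Suc t\<close> under a feasible
  control\<close>

context
  fixes u :: "nat \<Rightarrow> 'a \<Rightarrow> real^'m" and t :: nat
  assumes u: "u \<in> feasible" and t: "t < N"
begin

text \<open>\<open>pred_eta\<close> is the augmented state at time t + 1 with the noise replaced by its mean, so it
  is known at time t.\<close>

definition pred_eta :: "'a \<Rightarrow> nat \<Rightarrow> real^'n" where
  "pred_eta \<omega> j =
    (if j = 0 then A *v state u t \<omega> + B *v u t \<omega> + noise_mean else state u (Suc t - j) \<omega>)"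

text \<open>Half the gradient of the quadratic form with respect to the head block, taken at the
  predicted state; hence the coefficient of the noise in \<open>z\<close>.\<close>

definition pred_row :: "'a \<Rightarrow> real^'n" where
  "pred_row \<omega> = (\<Sum>j\<le>lag (Suc t). Q 0 j *v pred_eta \<omega> j)"

lemma control_measurable: "u t \<in> borel_measurable (hist_algebra u t)"
  using u t by (auto simp: feasible_def square_integrable_def)

lemma pred_eta_measurable: "(\<lambda>\<omega>. pred_eta \<omega> j) \<in> borel_measurable (hist_algebra u t)"
proof (cases "j = 0")
  case True
  have [measurable]: "state u t \<in> borel_measurable (hist_algebra u t)"
    "u t \<in> borel_measurable (hist_algebra u t)"
    by (simp_all add: state_hist_measurable control_measurable)
  show ?thesis using True by (simp add: pred_eta_def)
next
  case False
  then show ?thesis using state_hist_measurable[of "Suc t - j" t u] by (simp add: pred_eta_def)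
qed

lemma pred_eta_square_integrable: "square_integrable M M (\<lambda>\<omega>. pred_eta \<omega> j)"
proof (cases "j = 0")
  case True
  have "square_integrable M M (\<lambda>\<omega>. A *v state u t \<omega> + B *v u t \<omega> + noise_mean)"
    using t by (intro square_integrable_add square_integrable_mult_vec
      square_integrable_const control_square_integrable[OF u] state_square_integrable[OF u]) auto
  then show ?thesis using True by (simp add: pred_eta_def)
next
  case False
  then show ?thesis using state_square_integrable[OF u, of "Suc t - j"] t by (simp add: pred_eta_def)
qed

lemma pred_row_measurable: "pred_row \<in> borel_measurable (hist_algebra u t)"
  unfolding pred_row_def[abs_def]
  by (intro borel_measurable_sum borel_measurable_matrix_vector_mult pred_eta_measurable)

lemma pred_row_square_integrable: "square_integrable M M pred_row"
  unfolding pred_row_def[abs_def]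
  by (intro square_integrable_sum square_integrable_mult_vec pred_eta_square_integrable) simp

lemma pred_row_integrable: "integrable M pred_row"
  by (rule square_integrable_imp_integrable[OF pred_row_square_integrable])

lemma eta_head: "eta u (Suc t) \<omega> 0 = pred_eta \<omega> 0 + dev t \<omega>"
  and eta_tail: "0 < i \<Longrightarrow> i \<le> lag (Suc t) \<Longrightarrow> eta u (Suc t) \<omega> i = pred_eta \<omega> i"
  by (auto simp: eta_def pred_eta_def dev_def)

text \<open>The noise perturbs only the head block of \<open>pred_eta\<close>. The three terms are
  known at time \<open>t\<close>, conditionally centred, and independent of the history,
  respectively.\<close>

lemma z_decomp:
  "z u (Suc t) \<omega> = block_quad (lag (Suc t)) Q (pred_eta \<omega>) + 2 * (pred_row \<omega> \<bullet> dev t \<omega>)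
     + noise_quad (dev t \<omega>)"
  unfolding z_def pred_row_def noise_quad_def inner_commute[of _ "dev t \<omega>"]
  by (rule block_quad_perturb_head) (auto simp: eta_head eta_tail Q_transpose lag_def)

text \<open>The history lies in \<open>noise_algebra t\<close>, which is independent of
  \<open>w t\<close>. The result refers to \<open>noise_dev\<close> so that the time-independent
  noise statistics appear.\<close>

lemma hist_expectation_inner:
  fixes Y :: "'a \<Rightarrow> 'b::euclidean_space"
  assumes Y: "Y \<in> borel_measurable (hist_algebra u t)" "integrable M Y"
    and g: "g \<in> borel_measurable borel" "integrable M (\<lambda>\<omega>. g (dev t \<omega>))"
  shows "integrable M (\<lambda>\<omega>. Y \<omega> \<bullet> g (dev t \<omega>))"
    and "expectation (\<lambda>\<omega>. Y \<omega> \<bullet> g (dev t \<omega>)) = expectation Y \<bullet> expectation (\<lambda>\<omega>. g (noise_dev \<omega>))"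
proof -
  have Y': "Y \<in> borel_measurable (noise_algebra t)"
    by (rule measurable_from_subalg[OF hist_noise_subalgebra[OF u] Y(1)]) (use t in simp)
  have g': "(\<lambda>v. g (v - noise_mean)) \<in> borel_measurable borel" using g(1) by measurable
  note * = noise_algebra_expectation_inner[OF Y' Y(2) t g' g(2)[unfolded dev_def]]
  show "integrable M (\<lambda>\<omega>. Y \<omega> \<bullet> g (dev t \<omega>))" using *(1) by (simp add: dev_def)
  show "expectation (\<lambda>\<omega>. Y \<omega> \<bullet> g (dev t \<omega>)) = expectation Y \<bullet> expectation (\<lambda>\<omega>. g (noise_dev \<omega>))"
    using *(2) expectation_dev_eq[OF t g(1)] by (simp add: dev_def)
qed

lemma hist_expectation_mult_vec_dev:
  fixes P :: "real^'n^'c"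
  assumes "Y \<in> borel_measurable (hist_algebra u t)" "integrable M Y"
  shows "integrable M (\<lambda>\<omega>. Y \<omega> \<bullet> (P *v dev t \<omega>))"
    and "expectation (\<lambda>\<omega>. Y \<omega> \<bullet> (P *v dev t \<omega>)) = 0"
proof -
  have m: "(\<lambda>v. P *v v) \<in> borel_measurable borel" by measurable
  have i: "integrable M (\<lambda>\<omega>. P *v dev t \<omega>)"
    by (rule integrable_bounded_linear[OF matrix_vector_mul_bounded_linear dev_integrable_id[OF t]])
  show "integrable M (\<lambda>\<omega>. Y \<omega> \<bullet> (P *v dev t \<omega>))"
    by (rule hist_expectation_inner(1)[OF assms m i])
  \<comment> \<open>The product rule leaves the mean of \<open>P *v noise_dev\<close>, which is the
    case of time 0, since \<open>noise_dev = dev 0\<close>.\<close>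
  show "expectation (\<lambda>\<omega>. Y \<omega> \<bullet> (P *v dev t \<omega>)) = 0"
    using hist_expectation_inner(2)[OF assms m i] expectation_mult_vec_dev[of 0 P] N_pos
    by (simp add: noise_dev_eq)
qed

lemma hist_expectation_dev:
  fixes Y :: "'a \<Rightarrow> real^'n"
  assumes "Y \<in> borel_measurable (hist_algebra u t)" "integrable M Y"
  shows "integrable M (\<lambda>\<omega>. Y \<omega> \<bullet> dev t \<omega>)" and "expectation (\<lambda>\<omega>. Y \<omega> \<bullet> dev t \<omega>) = 0"
  using hist_expectation_mult_vec_dev[OF assms, of "mat 1"] by simp_all

text \<open>In \<open>z_decomp\<close> the conditional expectation keeps the first term, kills the
  second and replaces the third by its mean. The relevant history is the one at
  \<open>Suc t - 1 = t\<close>.\<close>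

lemma Delta_eq:
  "AE \<omega> in M. Delta u (Suc t) \<omega> =
    2 * (pred_row \<omega> \<bullet> dev t \<omega>) + (noise_quad (dev t \<omega>) - noise_quad_mean)"
proof -
  let ?F = "hist_algebra u t"
  let ?g = "\<lambda>\<omega>. block_quad (lag (Suc t)) Q (pred_eta \<omega>)"
  have sub: "subalgebra M ?F" using hist_subalgebra[OF u] t by simp
  interpret finite_measure_subalgebra M ?F by unfold_locales (rule sub)
  have g: "integrable M ?g" by (intro block_quad_integrable pred_eta_square_integrable)
  have gF: "?g \<in> borel_measurable ?F"
    unfolding block_quad_def
    by (intro borel_measurable_sum borel_measurable_inner borel_measurable_matrix_vector_mult
        pred_eta_measurable)
  have "AE \<omega> in M. real_cond_exp M ?F (z u (Suc t)) \<omega> = ?g \<omega> + noise_quad_mean"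
  proof (rule real_cond_exp_charact)
    fix S assume S: "S \<in> sets ?F"
    then have SM: "S \<in> sets M" using sub by (auto simp: subalgebra_def)
    \<comment> \<open>The indicator is absorbed into the factor known at time \<open>t\<close>, so
      the noise term integrates to zero over every \<open>S\<close> in the history.\<close>
    have ind: "(\<lambda>\<omega>. indicator S \<omega> *\<^sub>R pred_row \<omega>) \<in> borel_measurable ?F"
      using S pred_row_measurable by measurable
    have ind': "integrable M (\<lambda>\<omega>. indicator S \<omega> *\<^sub>R pred_row \<omega>)"
      by (rule integrable_mult_indicator[OF SM pred_row_integrable])
    note a = hist_expectation_dev[OF ind ind']
    have one: "(\<lambda>\<omega>. indicator S \<omega> :: real) \<in> borel_measurable ?F" using S by measurable
    have one': "integrable M (\<lambda>\<omega>. indicator S \<omega> :: real)"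
      using SM by (simp add: emeasure_eq_measure)
    note b = hist_expectation_inner[OF one one' noise_quad_measurable dev_integrable_quad[OF t]]
    have ig: "integrable M (\<lambda>\<omega>. indicator S \<omega> * ?g \<omega>)"
      using integrable_mult_indicator[OF SM g] by simp
    have "(\<integral>\<omega>\<in>S. z u (Suc t) \<omega> \<partial>M) = (\<integral>\<omega>. indicator S \<omega> * ?g \<omega> +
       (2 * ((indicator S \<omega> *\<^sub>R pred_row \<omega>) \<bullet> dev t \<omega>) + indicator S \<omega> \<bullet> noise_quad (dev t \<omega>)) \<partial>M)"
      unfolding set_lebesgue_integral_def z_decomp
      by (intro Bochner_Integration.integral_cong) (auto simp: algebra_simps)
    also have "\<dots> = (\<integral>\<omega>. indicator S \<omega> * ?g \<omega> \<partial>M) + (\<integral>\<omega>. indicator S \<omega> \<partial>M) * noise_quad_mean"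
      using a b ig by (simp add: noise_quad_mean_def)
    also have "\<dots> = (\<integral>\<omega>. indicator S \<omega> * ?g \<omega> + indicator S \<omega> * noise_quad_mean \<partial>M)"
      using ig one' by simp
    also have "\<dots> = (\<integral>\<omega>\<in>S. (?g \<omega> + noise_quad_mean) \<partial>M)"
      unfolding set_lebesgue_integral_def by (simp add: algebra_simps)
    finally show "(\<integral>\<omega>\<in>S. z u (Suc t) \<omega> \<partial>M) = (\<integral>\<omega>\<in>S. (?g \<omega> + noise_quad_mean) \<partial>M)" .
  next
    show "integrable M (z u (Suc t))" using z_integrable[OF u] t by simp
    show "integrable M (\<lambda>\<omega>. ?g \<omega> + noise_quad_mean)" using g by simp
    show "(\<lambda>\<omega>. ?g \<omega> + noise_quad_mean) \<in> borel_measurable ?F" using gF by measurable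
  qed
  then show ?thesis by eventually_elim (simp add: Delta_def z_decomp)
qed

lemma pred_row_outer_integrable: "integrable M (\<lambda>\<omega>. outer (pred_row \<omega>) (pred_row \<omega>))"
proof -
  have [measurable]: "pred_row \<in> borel_measurable M"
    using pred_row_square_integrable by (simp add: square_integrable_def)
  show ?thesis
    by (rule square_integrable_bilinear_integrable[OF pred_row_square_integrable pred_row_square_integrable, where C=1])
       (auto simp: norm_outer)
qed

text \<open>The control-dependent part common to the expected squared \<open>Delta\<close> and to
  the expected extra cost at time \<open>Suc t\<close>.\<close>

definition pred_penalty :: real where
  "pred_penalty = 4 * expectation (\<lambda>\<omega>. pred_row \<omega> \<bullet> (noise_cov *v pred_row \<omega>))
     + 4 * (expectation pred_row \<bullet> noise_skew)"

text \<open>Expanding the square gives products of a history factor and a noise factor. Their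
  expectations yield \<open>noise_cov\<close>, \<open>noise_skew\<close>, zero for the term linear
  in the noise, and a constant.\<close>

lemma
  shows Delta_square_integrable: "integrable M (\<lambda>\<omega>. (Delta u (Suc t) \<omega>)\<^sup>2)"
    and expectation_Delta_square:
      "expectation (\<lambda>\<omega>. (Delta u (Suc t) \<omega>)\<^sup>2) = pred_penalty + noise_quad_var"
proof -
  let ?q = pred_row and ?d = "dev t" and ?r = "\<lambda>\<omega>. noise_quad (dev t \<omega>)" and ?c = noise_quad_mean
  \<comment> \<open>The squared inner product is written with outer products, and the mixed term is
    split at \<open>?c\<close>, so that every summand has a separated form.\<close>
  let ?D = "\<lambda>\<omega>. 4 * (outer (?q \<omega>) (?q \<omega>) \<bullet> outer (?d \<omega>) (?d \<omega>)) + 4 * (?q \<omega> \<bullet> (?r \<omega> *\<^sub>R ?d \<omega>))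
     - 4 * ?c * (?q \<omega> \<bullet> ?d \<omega>) + (?r \<omega> - ?c)\<^sup>2"
  have D: "?D \<omega> = (2 * (?q \<omega> \<bullet> ?d \<omega>) + (?r \<omega> - ?c))\<^sup>2" for \<omega>
    by (simp add: inner_outer power2_eq_square algebra_simps)
  have AE: "AE \<omega> in M. (Delta u (Suc t) \<omega>)\<^sup>2 = ?D \<omega>"
    using Delta_eq by eventually_elim (simp only: D)
  have qq: "(\<lambda>\<omega>. outer (?q \<omega>) (?q \<omega>)) \<in> borel_measurable (hist_algebra u t)"
    by (intro borel_measurable_outer pred_row_measurable)
  have mo: "(\<lambda>v. outer v v) \<in> borel_measurable borel" by measurable
  have ms: "(\<lambda>v. noise_quad v *\<^sub>R v) \<in> borel_measurable borel" by measurable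
  note 1 = hist_expectation_inner[OF qq pred_row_outer_integrable mo dev_integrable_outer[OF t]]
  note 2 = hist_expectation_inner[OF pred_row_measurable pred_row_integrable ms dev_integrable_skew[OF t]]
  note 3 = hist_expectation_dev[OF pred_row_measurable pred_row_integrable]
  note 4 = dev_integrable_quad_sq[OF t, of ?c]
  \<comment> \<open>Since \<open>outer d d *v (Q 0 0 *v d)\<close> is
    \<open>noise_quad d *\<^sub>R d\<close>, the third-order statistic is a mean of noise vectors
    weighted by \<open>noise_quad\<close>.\<close>
  have skew: "noise_skew = expectation (\<lambda>\<omega>. noise_quad (noise_dev \<omega>) *\<^sub>R noise_dev \<omega>)"
    by (simp add: noise_skew_def outer_mult_vec noise_quad_def)
  have cov: "expectation (\<lambda>\<omega>. outer (?q \<omega>) (?q \<omega>)) \<bullet> noise_cov = expectation (\<lambda>\<omega>. ?q \<omega> \<bullet> (noise_cov *v ?q \<omega>))"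
    using pred_row_outer_integrable by (simp add: integral_inner_left[symmetric] outer_inner_matrix del: integral_inner_left)
  have var: "expectation (\<lambda>\<omega>. (?r \<omega> - ?c)\<^sup>2) = noise_quad_var"
    unfolding noise_quad_var_def by (rule expectation_dev_eq[OF t]) measurable
  have ID: "integrable M ?D" using 1(1) 2(1) 3(1) 4 by auto
  have "expectation ?D = 4 * expectation (\<lambda>\<omega>. outer (?q \<omega>) (?q \<omega>) \<bullet> outer (?d \<omega>) (?d \<omega>))
     + 4 * expectation (\<lambda>\<omega>. ?q \<omega> \<bullet> (?r \<omega> *\<^sub>R ?d \<omega>)) - 4 * ?c * expectation (\<lambda>\<omega>. ?q \<omega> \<bullet> ?d \<omega>)
     + expectation (\<lambda>\<omega>. (?r \<omega> - ?c)\<^sup>2)"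
    using 1(1) 2(1) 3(1) 4 by (simp del: inner_scaleR_right)
  also have "\<dots> = pred_penalty + noise_quad_var"
    unfolding 1(2) 2(2) 3(2) var skew[symmetric] noise_cov_def[symmetric] cov pred_penalty_def by simp
  finally have ED: "expectation ?D = pred_penalty + noise_quad_var" .
  have sub: "subalgebra M (hist_algebra u t)" using hist_subalgebra[OF u] t by simp
  have [measurable]: "Delta u (Suc t) \<in> borel_measurable M"
  proof -
    have [measurable]: "z u (Suc t) \<in> borel_measurable M"
      using z_integrable[OF u, of "Suc t"] t by auto
    have [measurable]: "real_cond_exp M (hist_algebra u t) (z u (Suc t)) \<in> borel_measurable M"
      by (rule measurable_from_subalg[OF sub]) (rule borel_measurable_cond_exp)
    show ?thesis unfolding Delta_def[abs_def] by simp
  qed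
  have mD: "?D \<in> borel_measurable M" using ID by auto
  show "integrable M (\<lambda>\<omega>. (Delta u (Suc t) \<omega>)\<^sup>2)"
    using integrable_cong_AE[OF _ mD AE] ID by simp
  show "expectation (\<lambda>\<omega>. (Delta u (Suc t) \<omega>)\<^sup>2) = pred_penalty + noise_quad_var"
    using integral_cong_AE[OF _ mD AE] ED by simp
qed

text \<open>The vector \<open>y\<close> of \<open>state_cost_eq\<close> splits into the known
  \<open>pred_row\<close> and the centred noise part \<open>Q 0 0 *v dev t\<close>. Mixed terms
  vanish in expectation, leaving one term in \<open>pred_row\<close> and one in the noise
  alone.\<close>

lemma expectation_state_cost:
  "expectation (\<lambda>\<omega>. state_cost (Suc t) (eta u (Suc t) \<omega>)) =
    expectation (z u (Suc t)) + lam * (pred_penalty + 4 * noise_cov_offset)"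
proof -
  let ?q = pred_row and ?d = "dev t" and ?b = "\<lambda>\<omega>. Q 0 0 *v dev t \<omega>"
  have y: "(\<Sum>j\<le>lag (Suc t). Q 0 j *v eta u (Suc t) \<omega> j) = ?q \<omega> + ?b \<omega>" for \<omega>
  proof -
    have "(\<Sum>j\<le>lag (Suc t). Q 0 j *v eta u (Suc t) \<omega> j) =
        (\<Sum>j\<le>lag (Suc t). Q 0 j *v pred_eta \<omega> j + (if j = 0 then ?b \<omega> else 0))"
      by (intro sum.cong) (auto simp: eta_head eta_tail matrix_vector_right_distrib)
    then show ?thesis by (simp add: sum.distrib pred_row_def sum.delta)
  qed
  have bsq: "square_integrable M M ?b"
    by (intro square_integrable_mult_vec dev_square_integrable t)
  have cq: "(\<lambda>\<omega>. noise_cov *v ?q \<omega>) \<in> borel_measurable (hist_algebra u t)"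
    by (intro borel_measurable_matrix_vector_mult pred_row_measurable)
  have cqi: "integrable M (\<lambda>\<omega>. noise_cov *v ?q \<omega>)"
    by (intro square_integrable_imp_integrable square_integrable_mult_vec pred_row_square_integrable)
  note 1 = square_integrable_inner_mult_vec_integrable[OF pred_row_square_integrable pred_row_square_integrable, of noise_cov]
  \<comment> \<open>Facts 2 and 3 treat the two mixed terms, with \<open>noise_cov\<close> applied
    to the noise part and to \<open>pred_row\<close> respectively.\<close>
  note 2 = hist_expectation_mult_vec_dev[OF pred_row_measurable pred_row_integrable, of "noise_cov ** Q 0 0"]
  note 3 = hist_expectation_mult_vec_dev[OF cq cqi, of "Q 0 0"]
  note 4 = square_integrable_inner_mult_vec_integrable[OF bsq bsq, of noise_cov]
  have bi: "integrable M ?b" by (rule square_integrable_imp_integrable[OF bsq])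
  have b0: "expectation ?b = 0" by (rule expectation_mult_vec_dev[OF t])
  have off: "expectation (\<lambda>\<omega>. ?b \<omega> \<bullet> (noise_cov *v ?b \<omega>)) = noise_cov_offset"
    unfolding noise_cov_offset_def
    by (rule expectation_dev_eq[OF t, of "\<lambda>v. (Q 0 0 *v v) \<bullet> (noise_cov *v (Q 0 0 *v v))"]) measurable
  have zi: "integrable M (z u (Suc t))" using z_integrable[OF u] t by simp
  have "state_cost (Suc t) (eta u (Suc t) \<omega>) = z u (Suc t) \<omega> + lam * (
      4 * (?q \<omega> \<bullet> (noise_cov *v ?q \<omega>)) + 4 * (?q \<omega> \<bullet> ((noise_cov ** Q 0 0) *v ?d \<omega>))
      + 4 * ((noise_cov *v ?q \<omega>) \<bullet> ?b \<omega>) + 4 * (?b \<omega> \<bullet> (noise_cov *v ?b \<omega>))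
      + 4 * (noise_skew \<bullet> ?q \<omega>) + 4 * (noise_skew \<bullet> ?b \<omega>))" for \<omega>
    unfolding state_cost_eq y z_def[symmetric]
    by (simp add: matrix_vector_right_distrib inner_add_left inner_add_right inner_commute
        matrix_vector_mul_assoc[symmetric] algebra_simps)
  then have "expectation (\<lambda>\<omega>. state_cost (Suc t) (eta u (Suc t) \<omega>)) = expectation (z u (Suc t)) + lam * (
      4 * expectation (\<lambda>\<omega>. ?q \<omega> \<bullet> (noise_cov *v ?q \<omega>))
      + 4 * expectation (\<lambda>\<omega>. ?q \<omega> \<bullet> ((noise_cov ** Q 0 0) *v ?d \<omega>))
      + 4 * expectation (\<lambda>\<omega>. (noise_cov *v ?q \<omega>) \<bullet> ?b \<omega>)
      + 4 * expectation (\<lambda>\<omega>. ?b \<omega> \<bullet> (noise_cov *v ?b \<omega>))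
      + 4 * (noise_skew \<bullet> expectation ?q) + 4 * (noise_skew \<bullet> expectation ?b))"
    using zi 1 2(1) 3(1) 4 bi pred_row_integrable by simp
  then show ?thesis
    unfolding 2(2) 3(2) off b0 pred_penalty_def by (simp add: inner_commute algebra_simps)
qed

text \<open>Comparing the two preceding expectations eliminates \<open>pred_penalty\<close>; the
  remaining offset depends neither on the control nor on the time.\<close>

lemma expectation_state_cost_Delta:
  "expectation (\<lambda>\<omega>. state_cost (Suc t) (eta u (Suc t) \<omega>)) =
    expectation (z u (Suc t)) + lam * (expectation (\<lambda>\<omega>. (Delta u (Suc t) \<omega>)\<^sup>2)
      + (4 * noise_cov_offset - noise_quad_var))"
  unfolding expectation_state_cost expectation_Delta_square by simp

end

text \<open>No \<open>Delta\<close> belongs to time 0. The augmented state there consists of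
  \<open>X0\<close> only, so its extra cost is the same for all controls.\<close>

definition initial_offset :: real where
  "initial_offset = expectation (\<lambda>\<omega>. state_cost 0 (\<lambda>i\<in>{..0}. X0 \<omega>))
     - expectation (\<lambda>\<omega>. block_quad 0 Q (\<lambda>i\<in>{..0}. X0 \<omega>))"

text \<open>Time 0 contributes \<open>initial_offset\<close>, and each of the \<open>N\<close>
  transitions contributes the same multiple of \<open>lam\<close>. The control costs are identical
  on both sides.\<close>

lemma J_aug_eq_J_risk:
  assumes u: "u \<in> feasible"
  shows "J_aug (eta u) u =
    J_risk u + (initial_offset + lam * real N * (4 * noise_cov_offset - noise_quad_var))"
proof -
  let ?C = "4 * noise_cov_offset - noise_quad_var"
  let ?s = "\<lambda>t. expectation (\<lambda>\<omega>. state_cost t (eta u t \<omega>))"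
  let ?z = "\<lambda>t. expectation (z u t)"
  let ?r = "\<lambda>t. expectation (\<lambda>\<omega>. u t \<omega> \<bullet> (R *v u t \<omega>))"
  let ?D = "\<lambda>t. expectation (\<lambda>\<omega>. (Delta u (Suc t) \<omega>)\<^sup>2)"
  \<comment> \<open>Stated for a generic state cost \<open>a\<close>, so that it applies both to
    \<open>state_cost\<close> and to \<open>z\<close>; the terminal term becomes the summand at
    \<open>N\<close>.\<close>
  have total: "expectation (\<lambda>\<omega>. a N \<omega> + (\<Sum>t<N. a t \<omega> + u t \<omega> \<bullet> (R *v u t \<omega>))) =
      (\<Sum>t\<le>N. expectation (a t)) + (\<Sum>t<N. ?r t)"
    if a: "\<And>t. t \<le> N \<Longrightarrow> integrable M (a t)" for a :: "nat \<Rightarrow> 'a \<Rightarrow> real"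
  proof -
    let ?c = "\<lambda>t \<omega>. a t \<omega> + u t \<omega> \<bullet> (R *v u t \<omega>)"
    have c: "integrable M (?c t)" "expectation (?c t) = expectation (a t) + ?r t" if "t < N" for t
      using a[of t] control_cost_integrable[OF u that] that by simp_all
    have "expectation (\<lambda>\<omega>. a N \<omega> + (\<Sum>t<N. ?c t \<omega>)) =
        expectation (a N) + expectation (\<lambda>\<omega>. \<Sum>t<N. ?c t \<omega>)"
      by (intro Bochner_Integration.integral_add Bochner_Integration.integrable_sum a c(1)) auto
    also have "expectation (\<lambda>\<omega>. \<Sum>t<N. ?c t \<omega>) = (\<Sum>t<N. expectation (?c t))"
      by (intro Bochner_Integration.integral_sum c(1)) auto
    finally show ?thesis by (simp add: c sum.distrib lessThan_Suc_atMost[symmetric])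
  qed
  have "eta u 0 \<omega> = (\<lambda>i\<in>{..0}. X0 \<omega>)" for \<omega> by (auto simp: eta_def lag_def)
  then have "?s 0 = ?z 0 + initial_offset"
    by (simp add: initial_offset_def z_def[abs_def] lag_def)
  moreover have "?s (Suc t) = ?z (Suc t) + lam * (?D t + ?C)" if "t < N" for t
    by (rule expectation_state_cost_Delta[OF u that])
  ultimately have "(\<Sum>t\<le>N. ?s t) = (\<Sum>t\<le>N. ?z t) + initial_offset + (\<Sum>t<N. lam * (?D t + ?C))"
    by (simp add: sum.atMost_shift sum.distrib)
  moreover have "J_aug (eta u) u = (\<Sum>t\<le>N. ?s t) + (\<Sum>t<N. ?r t)"
    unfolding J_aug_def stage_cost_def by (rule total) (rule state_cost_integrable[OF u])
  moreover have "J_risk u = (\<Sum>t\<le>N. ?z t) + (\<Sum>t<N. ?r t) + lam * (\<Sum>t<N. ?D t)"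
  proof -
    \<comment> \<open>Shifting the range \<open>1..N\<close> to \<open>t < N\<close> matches
      \<open>Delta\<close> at \<open>Suc t\<close> with the transition starting at
      \<open>t\<close>.\<close>
    have "expectation (\<lambda>\<omega>. \<Sum>t=1..N. (Delta u t \<omega>)\<^sup>2) = (\<Sum>t<N. ?D t)"
      using Delta_square_integrable[OF u] by (simp add: sum.atLeast1_atMost_eq)
    then show ?thesis
      unfolding J_risk_def by (simp only: total[of "z u", OF z_integrable[OF u]])
  qed
  moreover have "(\<Sum>t<N. lam * (?D t + ?C)) = lam * (\<Sum>t<N. ?D t) + lam * real N * ?C"
    by (simp only: sum_distrib_left[symmetric] sum.distrib) (simp add: algebra_simps)
  ultimately show ?thesis by simp
qed

text \<open>Objectives that differ by a constant on the same feasible set have the same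
  minimizers.\<close>

lemma optimal1_iff_optimal2: "optimal1 u \<longleftrightarrow> optimal2 u"
  unfolding optimal1_def optimal2_def attains_infimum_iff by (auto simp: J_aug_eq_J_risk)

lemma optimal3_iff_optimal2: "optimal3 u \<longleftrightarrow> optimal2 u"
proof -
  have "eta_dyn u = eta u" for u by (intro ext) (simp add: eta_dyn_eq_eta)
  then show ?thesis by (simp add: optimal2_def optimal3_def feasible_aug_eq)
qed

end

theorem theorem1:
  fixes M :: "'a measure"
    and N k :: nat
    and A :: "real^'n^'n"
    and B :: "real^'m^'n"
    and Q :: "nat \<Rightarrow> nat \<Rightarrow> real^'n^'n"
    and R :: "real^'m^'m"
    and lam :: real
    and xinit :: "real^'n"
    and X0 :: "'a \<Rightarrow> real^'n"
    and w :: "nat \<Rightarrow> 'a \<Rightarrow> real^'n"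
    and u :: "nat \<Rightarrow> 'a \<Rightarrow> real^'m"
  assumes "coupled_lq M N k Q R lam xinit X0 w"
    and "coupled_lq.optimal1 M N A B k Q R lam X0 w u
       \<or> coupled_lq.optimal2 M N A B k Q R lam X0 w u
       \<or> coupled_lq.optimal3 M N A B k Q R lam X0 w u"
  shows "coupled_lq.optimal1 M N A B k Q R lam X0 w u
       \<and> coupled_lq.optimal2 M N A B k Q R lam X0 w u
       \<and> coupled_lq.optimal3 M N A B k Q R lam X0 w u"
proof -
  interpret coupled_lq M N A B k Q R lam xinit X0 w by fact
  show ?thesis using assms(2) by (simp add: optimal1_iff_optimal2 optimal3_iff_optimal2)
qed

end
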